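(* Let $n\ge 2$, let $\Omega\subset\mathbb R^n$ be a bounded open set containing the origin $0$, and let $\varphi$ be a $C^1$ function defined in a neighborhood of $1$ satisfying $\varphi(1)=1$ and $\varphi'(1)<0$. Assume that $u\in C^0(\overline\Omega\setminus\{0\})$, that $v$ is $C^0$ in some open neighborhood of $\overline\Omega$ and $C^1$ in a neighborhood of $0$, and that $$v>0\ \text{ in }\overline\Omega,\qquad u>v\ \text{ on }\overline\Omega\setminus\{0\},\qquad \Delta u\le 0\ \text{ in }\Omega\setminus\{0\}.$$ For $x\in\mathbb R^n$ and $\lambda$ near $1$ set $v^{x,\lambda}_\varphi(y):=\varphi(\lambda)v(x+\lambda y)$. Assume also that there exists some $\epsilon_3>0$ such that for any $|x|<\epsilon_3$ and $|\lambda-1|<\epsilon_3$, $$\inf_{\Omega\setminus\{0\}}\left[u-v^{x,\lambda}_\varphi\right]=0\quad\text{implies}\quad\liminf_{|y|\to 0}\left[u-v^{x,\lambda}_\varphi\right](y)=0 .$$ Then: (1) if $\varphi'(1)<-1$, then $\liminf_{|x|\to 0}[u(x)-v(x)]>0$; (2) if $-1\le\varphi'(1)<0$, then either $\liminf_{|x|\to 0}[u(x)-v(x)]>0$, or $$\liminf_{|x|\to 0}[u(x)-v(x)]=0$$ and, for some $\epsilon>0$ and $V\in\mathbb R^n$, $$\psi(v(x))+V\cdot x\equiv 0,\qquad |x|<\epsilon,$$ where $$\psi(s):=\int_{v(0)}^s\frac{v(0)}{t}\,\varphi^{-1}\left(\frac{v(0)}{t}\right)dt .$$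
   Context: Since $u$ is only assumed continuous, $\Delta u\le 0$ is understood in the distribution sense. $\varphi^{-1}$ is the local inverse of $\varphi$ near $1$ (with $\varphi^{-1}(1)=1$), so that $\psi$ is defined for $s$ near $v(0)$. *)

theory Defs
  imports "HOL-Analysis.Analysis"
begin

definition partial :: "'n::finite \<Rightarrow> (real^'n \<Rightarrow> real) \<Rightarrow> real^'n \<Rightarrow> real" where
  "partial i f x = frechet_derivative f (at x) (axis i 1)"

definition laplacian :: "(real^'n::finite \<Rightarrow> real) \<Rightarrow> real^'n \<Rightarrow> real" where
  "laplacian f x = (\<Sum>i\<in>UNIV. partial i (partial i f) x)"

text \<open>\<open>Ck_on k S f\<close> says that \<open>f\<close> is of class \<open>C\<^sup>k\<close> on \<open>S\<close>; it is meant for open \<open>S\<close> only.\<close>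

primrec Ck_on :: "nat \<Rightarrow> (real^'n::finite) set \<Rightarrow> (real^'n \<Rightarrow> real) \<Rightarrow> bool" where
  "Ck_on 0 S f \<longleftrightarrow> continuous_on S f"
| "Ck_on (Suc k) S f \<longleftrightarrow> (\<forall>x\<in>S. f differentiable (at x)) \<and> (\<forall>i. Ck_on k S (partial i f))"

text \<open>Nonnegative functions in \<open>C\<^sub>c\<^sup>\<infinity>(S)\<close>, extended by zero to the whole space.\<close>

definition nonneg_test_functions :: "(real^'n::finite) set \<Rightarrow> (real^'n \<Rightarrow> real) set" where
  "nonneg_test_functions S =
     {\<eta>. (\<forall>k. Ck_on k UNIV \<eta>) \<and> compact (closure {x. \<eta> x \<noteq> 0}) \<and>
         closure {x. \<eta> x \<noteq> 0} \<subseteq> S \<and> (\<forall>x. \<eta> x \<ge> 0)}"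

text \<open>\<open>\<Delta>u \<le> 0\<close> in the sense of distributions on the open set \<open>S\<close>, for \<open>u\<close> continuous on \<open>S\<close>
  (each integrand is then continuous with compact support in \<open>S\<close>, hence integrable).\<close>

definition distr_laplacian_nonpos_on :: "(real^'n::finite) set \<Rightarrow> (real^'n \<Rightarrow> real) \<Rightarrow> bool" where
  "distr_laplacian_nonpos_on S u \<longleftrightarrow>
     (\<forall>\<eta>\<in>nonneg_test_functions S. (LINT x:S|lborel. u x * laplacian \<eta> x) \<le> 0)"

definition v_phi :: "(real \<Rightarrow> real) \<Rightarrow> (real^'n::finite \<Rightarrow> real) \<Rightarrow> real^'n \<Rightarrow> real \<Rightarrow> real^'n \<Rightarrow> real" where
  "v_phi \<phi> v x l y = \<phi> l * v (x + l *\<^sub>R y)"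

definition is_local_inverse :: "(real \<Rightarrow> real) \<Rightarrow> real \<Rightarrow> (real \<Rightarrow> real) \<Rightarrow> bool" where
  "is_local_inverse f a g \<longleftrightarrow>
     (\<exists>A B. open A \<and> open B \<and> a \<in> A \<and> homeomorphism A B f g)"

text \<open>A local inverse is unique only as a germ at \<open>f a\<close>: the values of \<open>local_inverse f a\<close> are
  meaningful only sufficiently close to \<open>f a\<close>. Existence and uniqueness of the germ are checked in
  \<open>is_local_inverse_local_inverse\<close> and \<open>is_local_inverse_unique\<close> below.\<close>

definition local_inverse :: "(real \<Rightarrow> real) \<Rightarrow> real \<Rightarrow> real \<Rightarrow> real" where
  "local_inverse f a = (SOME g. is_local_inverse f a g)"

text \<open>The function \<open>\<psi>\<close>, where \<open>c\<close> stands for \<open>v(0)\<close>; the integral is oriented, so that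
  \<open>s < c\<close> is allowed. By the previous remark, only the values for \<open>s\<close> near \<open>c\<close> are meaningful.\<close>

definition psi :: "(real \<Rightarrow> real) \<Rightarrow> real \<Rightarrow> real \<Rightarrow> real" where
  "psi \<phi> c s = (LBINT t=ereal c..ereal s. c / t * local_inverse \<phi> 1 (c / t))"

lemma is_local_inverse_local_inverse:
  assumes "open J" "a \<in> J" "f C1_differentiable_on J" "deriv f a \<noteq> 0"
  shows "is_local_inverse f a (local_inverse f a)"
proof -
  obtain D where D: "\<And>x. x \<in> J \<Longrightarrow> (f has_real_derivative D x) (at x)" and cD: "continuous_on J D"
    using assms(3) unfolding C1_differentiable_on_def
    by (auto simp: has_real_derivative_iff_has_vector_derivative)
  have "D a \<noteq> 0" using D[OF assms(2)] assms(4) by (simp add: DERIV_imp_deriv)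
  obtain e where e: "e > 0" "ball a e \<subseteq> J" "\<And>x. x \<in> ball a e \<Longrightarrow> D x \<noteq> 0"
  proof -
    have "open {x\<in>J. D x \<noteq> 0}"
    proof -
      have "open (J \<inter> D -` (- {0}))"
        by (rule continuous_open_preimage[OF cD assms(1)]) auto
      thus ?thesis by (simp add: Int_def vimage_def)
    qed
    moreover have "a \<in> {x\<in>J. D x \<noteq> 0}" using assms \<open>D a \<noteq> 0\<close> by simp
    ultimately show ?thesis using that unfolding open_contains_ball by blast
  qed
  have cont: "continuous_on (ball a e) f"
    using D e(2) by (meson DERIV_isCont continuous_at_imp_continuous_on subsetD)
  have inj: "inj_on f (ball a e)"
  proof (rule inj_onI, rule ccontr)
    fix x y assume xy: "x \<in> ball a e" "y \<in> ball a e" "f x = f y" "x \<noteq> y"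
    have *: False if "x < y" "x \<in> ball a e" "y \<in> ball a e" "f x = f y" for x y
    proof -
      have sub: "z \<in> ball a e" if "x \<le> z" "z \<le> y" for z
        using that \<open>x \<in> ball a e\<close> \<open>y \<in> ball a e\<close> by (auto simp: dist_real_def)
      have "\<exists>z. z > x \<and> z < y \<and> f y - f x = (y - x) * D z"
        using MVT2[of x y f D] D e(2) sub \<open>x < y\<close> by blast
      then obtain z where "x < z" "z < y" "(y - x) * D z = 0" using \<open>f x = f y\<close> by auto
      thus False using e(3)[OF sub[of z]] by auto
    qed
    show False using *[of x y] *[of y x] xy by linarith
  qed
  obtain g where g: "homeomorphism (ball a e) (f ` ball a e) f g"
    using injective_into_1d_eq_homeomorphism[OF cont] inj by (auto simp: convex_imp_path_connected)
  have "open (f ` ball a e)"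
    using injective_eq_1d_open_map_UNIV[of "ball a e" f] cont inj
    by (simp add: is_interval_convex_1)
  hence "is_local_inverse f a g" unfolding is_local_inverse_def
    using g e(1) by (intro exI[of _ "ball a e"] exI[of _ "f ` ball a e"]) auto
  thus ?thesis unfolding local_inverse_def by (rule someI[of "is_local_inverse f a"])
qed

lemma is_local_inverse_unique:
  assumes "is_local_inverse f a g" "is_local_inverse f a h"
  shows "\<forall>\<^sub>F s in nhds (f a). g s = h s"
proof -
  obtain A B where 1: "open A" "open B" "a \<in> A" "homeomorphism A B f g"
    using assms(1) unfolding is_local_inverse_def by blast
  obtain A' B' where 2: "open A'" "a \<in> A'" "homeomorphism A' B' f h"
    using assms(2) unfolding is_local_inverse_def by blast
  have "open (B \<inter> g -` A')"
    using 1 2 by (intro continuous_open_preimage) (auto simp: homeomorphism_def)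
  moreover have "f a \<in> B \<inter> g -` A'" using 1 2 by (auto simp: homeomorphism_def)
  moreover have "g s = h s" if "s \<in> B \<inter> g -` A'" for s
  proof -
    have "f (g s) = s" "h (f (g s)) = g s" using 1 2 that by (auto simp: homeomorphism_def)
    thus ?thesis by simp
  qed
  ultimately show ?thesis unfolding eventually_nhds by blast
qed

end

theory Submission
  imports Defs
begin

text \<open>Suppose that the lower limit of \<open>u - v\<close> at the origin is not positive; since \<open>u > v\<close>, it is
  zero. Then \<open>v\<close> touches \<open>u\<close> at the singular point. The point of the proof is that \<open>v\<close> is not the only
  such function. For every small \<open>x\<close> let \<open>l(x)\<close> be the solution near \<open>1\<close> of \<open>\<phi> (l(x)) * v x = v 0\<close>.
  Then \<open>y \<mapsto> \<phi> (l(x)) * v (x + l(x) y)\<close> takes the value \<open>v 0\<close> at the origin as well, and it also lies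
  below \<open>u\<close> (\<open>touching_dilation\<close>): for a suitable larger parameter the dilation is strictly below \<open>u\<close>,
  because \<open>\<phi>\<close> decreases, and while the parameter decreases to \<open>l(x)\<close> the infimum of the difference
  cannot become zero, because by hypothesis this would force contact at the origin.

  A superharmonic function with an isolated singularity cannot be touched there by two minorants
  with different gradients: it would lie above a wedge, whose spherical means exceed the value at the
  edge (\<open>distr_superharmonic_gradient_unique\<close>). Comparing the gradients of \<open>v\<close> and of its dilation
  yields \<open>\<phi> (l(x)) * l(x) * \<nabla>v(x) = \<nabla>v(0)\<close> (\<open>gradient_relation\<close>). The factor
  is the derivative of \<open>psi\<close> at \<open>v x\<close>, so \<open>psi \<phi> (v 0) (v x)\<close> is a linear function of \<open>x\<close>
  (\<open>psi_eq_affine\<close>). If \<open>deriv \<phi> 1 < -1\<close>, then \<open>psi\<close> lies below its tangent at \<open>v 0\<close>; hence \<open>v\<close> lies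
  above its tangent plane at the origin, and \<open>u\<close> strictly above that plane, contradicting
  the minimum principle once more (\<open>deriv_ge_minus_1\<close>).

  The potential theory behind this is obtained from the distributional inequality itself, by testing
  with radial functions that are smoothed truncations of the fundamental solution
  (\<open>radial_profile\<close>). They show that \<open>u\<close> cannot be touched from below by a function with positive
  Laplacian (\<open>distr_superharmonic_no_touching\<close>). A barrier \<open>\<delta> ln \<bar>x\<bar>\<^sup>2\<close> extends the resulting
  comparison principle over the singularity
  (\<open>distr_superharmonic_ge_quadratic_on_punctured_ball\<close>), and explicit quadratic polynomials then take
  the place of spherical means.\<close>

section \<open>Smooth functions of one variable and radial profiles\<close>

text \<open>Smooth functions of one real variable. The recursion hands out a derivative together with its
  regularity, so that closure properties follow by induction on \<open>k\<close> without computing higher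
  derivatives.\<close>

primrec Ck_real :: "nat \<Rightarrow> (real \<Rightarrow> real) \<Rightarrow> bool" where
  "Ck_real 0 f \<longleftrightarrow> continuous_on UNIV f"
| "Ck_real (Suc k) f \<longleftrightarrow> (\<exists>f'. (\<forall>x. (f has_real_derivative f' x) (at x)) \<and> Ck_real k f')"

definition smooth_real :: "(real \<Rightarrow> real) \<Rightarrow> bool" where
  "smooth_real f \<longleftrightarrow> (\<forall>k. Ck_real k f)"

lemma Ck_real_Suc_D: "Ck_real (Suc k) f \<Longrightarrow> Ck_real k f"
proof (induction k arbitrary: f)
  case 0
  then show ?case
    by (metis Ck_real.simps continuous_at_imp_continuous_on DERIV_isCont)
next
  case (Suc k)
  then show ?case by (metis Ck_real.simps(2))
qed

lemma Ck_real_derivD: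
  assumes "Ck_real (Suc k) f" "\<And>x. (f has_real_derivative f' x) (at x)"
  shows "Ck_real k f'"
proof -
  obtain g where g: "\<And>x. (f has_real_derivative g x) (at x)" "Ck_real k g" using assms(1) by auto
  have "g = f'" using g(1) assms(2) DERIV_unique by blast
  thus ?thesis using g by simp
qed

lemma Ck_real_const [simp]: "Ck_real k (\<lambda>x. a)"
proof (induction k arbitrary: a)
  case (Suc k)
  have "((\<lambda>x::real. a) has_real_derivative 0) (at x)" for x by simp
  thus ?case unfolding Ck_real.simps using Suc.IH[of 0] by (intro exI[of _ "\<lambda>x. 0"]) blast
qed simp

lemma Ck_real_add: "Ck_real k f \<Longrightarrow> Ck_real k g \<Longrightarrow> Ck_real k (\<lambda>x. f x + g x)"
proof (induction k arbitrary: f g)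
  case 0 thus ?case by (simp add: continuous_on_add continuous_on_mult)
next
  case (Suc k)
  then obtain f' g' where d: "\<And>x. (f has_real_derivative f' x) (at x)" "Ck_real k f'"
    "\<And>x. (g has_real_derivative g' x) (at x)" "Ck_real k g'"
    unfolding Ck_real.simps by (elim exE conjE) blast
  have "Ck_real k (\<lambda>x. f' x + g' x)" by (rule Suc.IH) (rule d)+
  moreover have "((\<lambda>x. f x + g x) has_real_derivative f' x + g' x) (at x)" for x
    by (rule DERIV_add) (rule d)+
  ultimately show ?case unfolding Ck_real.simps by (intro exI[of _ "\<lambda>x. f' x + g' x"]) simp
qed

lemma Ck_real_mult: "Ck_real k f \<Longrightarrow> Ck_real k g \<Longrightarrow> Ck_real k (\<lambda>x. f x * g x)"
proof (induction k arbitrary: f g)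
  case 0 thus ?case by (simp add: continuous_on_add continuous_on_mult)
next
  case (Suc k)
  then obtain f' g' where d: "\<And>x. (f has_real_derivative f' x) (at x)" "Ck_real k f'"
    "\<And>x. (g has_real_derivative g' x) (at x)" "Ck_real k g'"
    unfolding Ck_real.simps by (elim exE conjE) blast
  have "Ck_real k (\<lambda>x. f' x * g x + g' x * f x)"
    using Suc.prems by (intro Ck_real_add Suc.IH d) (rule Ck_real_Suc_D, assumption)+
  moreover have "((\<lambda>x. f x * g x) has_real_derivative f' x * g x + g' x * f x) (at x)" for x
    by (rule DERIV_mult) (rule d)+
  ultimately show ?case unfolding Ck_real.simps
    by (intro exI[of _ "\<lambda>x. f' x * g x + g' x * f x"]) simp
qed

lemma Ck_real_affine: "Ck_real k f \<Longrightarrow> Ck_real k (\<lambda>x. f (a * x + b))"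
proof (induction k arbitrary: f)
  case 0
  hence "continuous_on UNIV f" by simp
  hence "continuous_on UNIV (\<lambda>x. f (a * x + b))"
    by (rule continuous_on_compose2) (intro continuous_intros, simp)
  thus ?case by simp
next
  case (Suc k)
  then obtain f' where d: "\<And>x. (f has_real_derivative f' x) (at x)" "Ck_real k f'"
    unfolding Ck_real.simps by (elim exE conjE) blast
  have "((\<lambda>x. f (a * x + b)) has_real_derivative a * f' (a * x + b)) (at x)" for x
    by (rule DERIV_chain2[where g = "\<lambda>x. a*x+b" and f = f, OF d(1), THEN DERIV_cong])
       (auto intro!: derivative_eq_intros)
  moreover have "Ck_real k (\<lambda>x. a * f' (a * x + b))"
    by (rule Ck_real_mult[OF Ck_real_const Suc.IH[OF d(2)]])
  ultimately show ?case unfolding Ck_real.simps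
    by (intro exI[of _ "\<lambda>x. a * f' (a * x + b)"] conjI allI)
qed

lemma smooth_realI:
  assumes "\<And>x. (f has_real_derivative f' x) (at x)" "smooth_real f'"
  shows "smooth_real f"
  unfolding smooth_real_def
proof
  fix k
  have "\<forall>x. (f has_real_derivative f' x) (at x)" "Ck_real k f'"
    using assms by (blast, simp add: smooth_real_def)
  hence "Ck_real (Suc k) f" unfolding Ck_real.simps by (intro exI[of _ f'] conjI)
  thus "Ck_real k f" by (rule Ck_real_Suc_D)
qed

lemma smooth_real_deriv:
  assumes "smooth_real f" "\<And>x. (f has_real_derivative f' x) (at x)"
  shows "smooth_real f'"
  unfolding smooth_real_def
proof
  fix k
  have "Ck_real (Suc k) f" using assms(1) unfolding smooth_real_def by blast
  thus "Ck_real k f'" by (rule Ck_real_derivD) (rule assms(2))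
qed

lemma smooth_real_continuous: "smooth_real f \<Longrightarrow> continuous_on UNIV f"
  unfolding smooth_real_def by (drule spec[of _ 0]) simp

lemma smooth_real_const: "smooth_real (\<lambda>x. a)"
  by (simp add: smooth_real_def)

lemma smooth_real_add: "smooth_real f \<Longrightarrow> smooth_real g \<Longrightarrow> smooth_real (\<lambda>x. f x + g x)"
  by (simp add: smooth_real_def Ck_real_add)

lemma smooth_real_mult: "smooth_real f \<Longrightarrow> smooth_real g \<Longrightarrow> smooth_real (\<lambda>x. f x * g x)"
  by (simp add: smooth_real_def Ck_real_mult)

lemma smooth_real_affine: "smooth_real f \<Longrightarrow> smooth_real (\<lambda>x. f (a * x + b))"
  by (simp add: smooth_real_def Ck_real_affine[of _ f a b])

text \<open>The classical smooth function that is flat at \<open>0\<close> is the member \<open>j = 0\<close>. The other members are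
  there because the linear span of the family is closed under differentiation, so that smoothness of
  all of them follows by induction from one limit at \<open>0\<close>.\<close>

definition flat_exp :: "nat \<Rightarrow> real \<Rightarrow> real" where
  "flat_exp j t = (if t > 0 then inverse t ^ j * exp (- inverse t) else 0)"

lemma flat_exp_tendsto_0: "(flat_exp j \<longlongrightarrow> 0) (at 0)"
proof -
  have "((\<lambda>x::real. x ^ j / exp x) \<longlongrightarrow> 0) at_top" by (rule tendsto_power_div_exp_0)
  hence "((\<lambda>t::real. inverse t ^ j / exp (inverse t)) \<longlongrightarrow> 0) (at_right 0)"
    by (rule filterlim_compose[OF _ filterlim_inverse_at_top_right])
  hence "(flat_exp j \<longlongrightarrow> 0) (at_right 0)"
    by (rule Lim_transform_eventually)
       (auto simp: eventually_at_filter flat_exp_def exp_minus field_simps)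
  moreover have "(flat_exp j \<longlongrightarrow> 0) (at_left 0)"
    by (rule tendsto_eventually) (auto simp: eventually_at_filter flat_exp_def)
  ultimately show ?thesis by (simp add: filterlim_split_at_real)
qed

lemma flat_exp_deriv:
  "(flat_exp j has_real_derivative (flat_exp (j+2) t - j * flat_exp (j+1) t)) (at t)"
proof -
  consider "t > 0" | "t < 0" | "t = 0" by linarith
  thus ?thesis
  proof cases
    case 1
    have "((\<lambda>t. inverse t ^ j * exp (- inverse t)) has_real_derivative
        (flat_exp (j+2) t - j * flat_exp (j+1) t)) (at t)"
    proof -
      have e: "real j * inverse t ^ (j - Suc 0) * inverse t = real j * inverse t ^ j"
        by (cases j) auto
      have "((\<lambda>t. inverse t ^ j * exp (- inverse t)) has_real_derivative
          (real j * inverse t ^ (j - Suc 0) * (- (inverse t * inverse t))) * exp (- inverse t)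
          + inverse t ^ j * (exp (- inverse t) * (inverse t * inverse t))) (at t)"
        using 1 by (auto intro!: derivative_eq_intros simp: algebra_simps)
      also have "(real j * inverse t ^ (j - Suc 0) * (- (inverse t * inverse t))) * exp (- inverse t)
          = - (real j * inverse t ^ (j - Suc 0) * inverse t) * inverse t * exp (- inverse t)"
        by simp
      finally show ?thesis
        using 1 unfolding e by (simp add: flat_exp_def power2_eq_square algebra_simps)
    qed
    thus ?thesis
      by (rule DERIV_cong_ev[THEN iffD1, OF refl _ refl, rotated])
         (use 1 in \<open>auto simp: flat_exp_def intro!: eventually_nhds_in_open[of "{0<..}", THEN eventually_mono]\<close>)
  next
    case 2
    have "((\<lambda>t. 0) has_real_derivative (flat_exp (j+2) t - j * flat_exp (j+1) t)) (at t)"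
      using 2 by (auto simp: flat_exp_def)
    thus ?thesis
      by (rule DERIV_cong_ev[THEN iffD1, OF refl _ refl, rotated])
         (use 2 in \<open>auto simp: flat_exp_def intro!: eventually_nhds_in_open[of "{..<0}", THEN eventually_mono]\<close>)
  next
    case 3
    have "((\<lambda>h. (flat_exp j (0 + h) - flat_exp j 0) / h) \<longlongrightarrow> 0) (at 0)"
      using flat_exp_tendsto_0[of "Suc j"]
      by (rule Lim_transform_eventually)
         (auto simp: eventually_at_filter flat_exp_def field_simps)
    thus ?thesis using 3 by (simp add: DERIV_def flat_exp_def)
  qed
qed

lemma smooth_flat_exp: "smooth_real (flat_exp j)"
proof -
  have "Ck_real k (flat_exp j)" for k
  proof (induction k arbitrary: j)
    case 0
    show ?case unfolding Ck_real.simps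
      by (metis flat_exp_deriv continuous_at_imp_continuous_on DERIV_isCont)
  next
    case (Suc k)
    have "Ck_real k (\<lambda>t. flat_exp (j+2) t + (- real j) * flat_exp (j+1) t)"
      by (intro Ck_real_add Ck_real_mult Suc.IH Ck_real_const)
    hence "Ck_real k (\<lambda>t. flat_exp (j+2) t - real j * flat_exp (j+1) t)" by simp
    with flat_exp_deriv[of j] show ?case unfolding Ck_real.simps by (intro exI conjI allI)
  qed
  thus ?thesis by (simp add: smooth_real_def)
qed

lemma real_antiderivative:
  fixes f :: "real \<Rightarrow> real"
  assumes "continuous_on UNIV f"
  obtains F where "\<And>x. (F has_real_derivative f x) (at x)"
proof -
  have "\<exists>F. \<forall>x::real. (-\<infinity>::ereal) < x \<longrightarrow> x < (\<infinity>::ereal) \<longrightarrow> (F has_vector_derivative f x) (at x)"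
    by (rule einterval_antiderivative) (use assms in \<open>auto simp: continuous_on_eq_continuous_at\<close>)
  thus ?thesis using that by (auto simp: has_real_derivative_iff_has_vector_derivative)
qed

text \<open>The step is the normalised antiderivative of the bump \<open>e\<^sup>-\<^sup>1\<^sup>/\<^sup>(\<^sup>x\<^sup>-\<^sup>a\<^sup>) e\<^sup>-\<^sup>1\<^sup>/\<^sup>(\<^sup>b\<^sup>-\<^sup>x\<^sup>)\<close>. The sign
  of its derivative is what makes the sign of the Laplacian of the radial test functions visible.\<close>

lemma smooth_step:
  fixes a b :: real
  assumes "a < b"
  obtains S S' where "\<And>x. (S has_real_derivative S' x) (at x)" "smooth_real S"
    "\<And>x. x \<le> a \<Longrightarrow> S x = 0" "\<And>x. x \<ge> b \<Longrightarrow> S x = 1" "\<And>x. S' x \<ge> 0"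
    "\<And>x. a < x \<Longrightarrow> x < b \<Longrightarrow> S' x > 0" "\<And>x. x \<le> a \<or> x \<ge> b \<Longrightarrow> S' x = 0"
proof -
  define h where "h x = flat_exp 0 (1 * x + (-a)) * flat_exp 0 ((-1) * x + b)" for x
  have sh: "smooth_real h"
    unfolding h_def by (intro smooth_real_mult smooth_real_affine smooth_flat_exp)
  have h0: "h x = 0" if "x \<le> a \<or> x \<ge> b" for x
    using that by (auto simp: h_def flat_exp_def)
  have hpos: "h x > 0" if "a < x" "x < b" for x
    using that by (auto simp: h_def flat_exp_def)
  have hnn: "h x \<ge> 0" for x using h0[of x] hpos[of x] by (cases "x \<le> a \<or> x \<ge> b") auto
  obtain F where F: "\<And>x. (F has_real_derivative h x) (at x)"
    using real_antiderivative[OF smooth_real_continuous[OF sh]] by blast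
  have FC: "continuous_on A F" for A
    by (meson DERIV_isCont F continuous_at_imp_continuous_on)
  have Fa: "F x = F a" if "x \<le> a" for x
  proof (cases "x = a")
    case False
    with that have "x < a" by simp
    then obtain z where "x < z" "z < a" "F a - F x = (a - x) * h z"
      using MVT2[of x a F h] F by blast
    thus ?thesis using h0 by simp
  qed simp
  have Fb: "F x = F b" if "x \<ge> b" for x
  proof (cases "x = b")
    case False
    with that have "b < x" by simp
    then obtain z where "b < z" "z < x" "F x - F b = (x - b) * h z"
      using MVT2[of b x F h] F by blast
    thus ?thesis using h0 by simp
  qed simp
  have "F b - F a > 0"
  proof -
    obtain z where "a < z" "z < b" "F b - F a = (b - a) * h z"
      using MVT2[of a b F h] F assms by blast
    thus ?thesis using hpos[of z] assms by simp
  qed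
  define M where "M = F b - F a"
  have M: "M > 0" using \<open>F b - F a > 0\<close> by (simp add: M_def)
  define S where "S x = (F x - F a) / M" for x
  have d: "(S has_real_derivative h x / M) (at x)" for x
    unfolding S_def using M by (auto intro!: derivative_eq_intros F)
  have "smooth_real (\<lambda>x. h x * inverse M)" by (intro smooth_real_mult sh smooth_real_const)
  hence "smooth_real S" by (intro smooth_realI[OF d]) (simp add: divide_inverse)
  show ?thesis
  proof (rule that[of S "\<lambda>x. h x / M", OF d \<open>smooth_real S\<close>])
    show "S x = 0" if "x \<le> a" for x using Fa[OF that] by (simp add: S_def)
    show "S x = 1" if "x \<ge> b" for x using Fb[OF that] M by (simp add: S_def M_def)
  qed (use M h0 hpos hnn in simp_all)
qed

text \<open>The singularity of the power at \<open>0\<close> does no harm, since the other factor vanishes near it. The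
  exponent drops by one under differentiation, hence the induction over all exponents and all
  factors \<open>b\<close> at once.\<close>

lemma smooth_real_powr_mult:
  assumes "smooth_real b" "\<sigma> > 0" "\<And>x. x < \<sigma> \<Longrightarrow> b x = 0"
  shows "smooth_real (\<lambda>x. x powr a * b x)"
proof -
  have "Ck_real k (\<lambda>x. x powr a * b x)" if "Ck_real (Suc k) b" "\<And>x. x < \<sigma> \<Longrightarrow> b x = 0" for k
    using that
  proof (induction k arbitrary: a b)
    case (Suc k)
    obtain b' where b': "\<And>x. (b has_real_derivative b' x) (at x)" "Ck_real (Suc k) b'"
      using Suc.prems(1) Ck_real.simps(2)[of "Suc k" b] by metis
    have b'0: "b' x = 0" if "x < \<sigma>" for x
    proof -
      have "((\<lambda>x. 0) has_real_derivative 0) (at x)" by simp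
      hence "(b has_real_derivative 0) (at x)"
        by (rule DERIV_cong_ev[THEN iffD1, OF refl _ refl, rotated])
           (use that Suc.prems in \<open>auto intro!: eventually_nhds_in_open[of "{..<\<sigma>}", THEN eventually_mono]\<close>)
      thus ?thesis using b'(1) DERIV_unique by blast
    qed
    have "((\<lambda>x. x powr a * b x) has_real_derivative a * (x powr (a - 1) * b x) + x powr a * b' x) (at x)" for x
    proof (cases "x > 0")
      case True
      thus ?thesis by (auto intro!: derivative_eq_intros b' simp: field_simps)
    next
      case False
      have "((\<lambda>x. 0) has_real_derivative a * (x powr (a - 1) * b x) + x powr a * b' x) (at x)"
        using b'0[of x] Suc.prems(2)[of x] False assms(2) by simp
      thus ?thesis
        by (rule DERIV_cong_ev[THEN iffD1, OF refl _ refl, rotated])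
           (use False assms(2) Suc.prems in \<open>auto intro!: eventually_nhds_in_open[of "{..<\<sigma>}", THEN eventually_mono]\<close>)
    qed
    moreover have "Ck_real k (\<lambda>x. a * (x powr (a - 1) * b x) + x powr a * b' x)"
      using Suc.IH Ck_real_Suc_D[OF Suc.prems(1)] Suc.prems(2) b'(2) b'0
      by (intro Ck_real_add Ck_real_mult[of _ "\<lambda>x. a"] Ck_real_const) blast+
    ultimately show ?case unfolding Ck_real.simps by (intro exI conjI allI)
  next
    case 0
    have "isCont (\<lambda>x. x powr a * b x) x" for x
    proof (cases "x > 0")
      case True
      have "isCont b x" using 0 by (auto intro: DERIV_isCont)
      thus ?thesis using True by (auto intro!: continuous_intros)
    next
      case False
      have "\<forall>\<^sub>F y in nhds x. y powr a * b y = 0"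
        using False assms(2) 0(2) by (auto intro!: eventually_nhds_in_open[of "{..<\<sigma>}", THEN eventually_mono])
      from isCont_cong[OF this] show ?thesis by simp
    qed
    thus ?case by (simp add: continuous_on_eq_continuous_at)
  qed
  thus ?thesis using assms unfolding smooth_real_def by blast
qed


text \<open>For \<open>\<eta>(x) = G(\<bar>x\<bar>\<^sup>2)\<close> in dimension \<open>n\<close> the Laplacian is \<open>4 r G''(r) + 2 n G'(r)\<close> with
  \<open>r = \<bar>x\<bar>\<^sup>2\<close>. Writing \<open>G' = - r\<^sup>-\<^sup>n\<^sup>/\<^sup>2 b\<close> turns it into \<open>- 4 r\<^sup>1\<^sup>-\<^sup>n\<^sup>/\<^sup>2 b'\<close>. With \<open>b\<close> rising from \<open>0\<close> to
  \<open>1\<close> on \<open>[s/2, s]\<close> and falling back to \<open>0\<close> on \<open>[R1, R2]\<close>, the resulting \<open>\<eta>\<close> is a smoothed and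
  truncated fundamental solution: testing with it compares an average over a tiny ball with an
  average over a distant shell, and nothing in between contributes.\<close>

lemma radial_profile:
  fixes n s R1 R2 :: real
  assumes "0 < s" "s < R1" "R1 < R2"
  obtains G G' G'' where
    "\<And>r. (G has_real_derivative G' r) (at r)" "\<And>r. (G' has_real_derivative G'' r) (at r)"
    "smooth_real G" "\<And>r. G r \<ge> 0" "\<And>r. r \<ge> R2 \<Longrightarrow> G r = 0"
    "\<And>r. r \<le> s \<Longrightarrow> 4 * r * G'' r + 2 * n * G' r \<le> 0"
    "\<And>r. s \<le> r \<Longrightarrow> r \<le> R1 \<Longrightarrow> 4 * r * G'' r + 2 * n * G' r = 0"
    "\<And>r. R1 < r \<Longrightarrow> r < R2 \<Longrightarrow> 4 * r * G'' r + 2 * n * G' r > 0"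
    "\<And>r. R2 \<le> r \<Longrightarrow> 4 * r * G'' r + 2 * n * G' r = 0"
proof -
  obtain S S' where S: "\<And>x. (S has_real_derivative S' x) (at x)" "smooth_real S"
    "\<And>x. x \<le> s/2 \<Longrightarrow> S x = 0" "\<And>x. x \<ge> s \<Longrightarrow> S x = 1" "\<And>x. S' x \<ge> 0"
    "\<And>x. x \<le> s/2 \<or> x \<ge> s \<Longrightarrow> S' x = 0"
    by (rule smooth_step[of "s/2" s]) (use assms in auto)
  obtain T T' where T: "\<And>x. (T has_real_derivative T' x) (at x)" "smooth_real T"
    "\<And>x. x \<le> R1 \<Longrightarrow> T x = 0" "\<And>x. x \<ge> R2 \<Longrightarrow> T x = 1" "\<And>x. T' x \<ge> 0"
    "\<And>x. R1 < x \<Longrightarrow> x < R2 \<Longrightarrow> T' x > 0" "\<And>x. x \<le> R1 \<or> x \<ge> R2 \<Longrightarrow> T' x = 0"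
    by (rule smooth_step[of R1 R2]) (use assms in auto)
  define b where "b x = S x + (-1) * T x" for x
  define b' where "b' x = S' x - T' x" for x
  have b: "(b has_real_derivative b' x) (at x)" for x
    unfolding b_def b'_def by (auto intro!: derivative_eq_intros S T)
  have sb: "smooth_real b" unfolding b_def
    by (rule smooth_real_add[OF S(2) smooth_real_mult[OF smooth_real_const T(2)]])
  have b0: "b x = 0" "b' x = 0" if "x < s/2" for x
    using that assms S(3)[of x] T(3)[of x] S(6)[of x] T(7)[of x] by (auto simp: b_def b'_def)
  have bR: "b x = 0" if "x \<ge> R2" for x
    using that S(4)[of x] T(4)[of x] assms by (simp add: b_def)
  have Smono: "S x \<le> S y" if "x \<le> y" for x y
    by (rule DERIV_nonneg_imp_nondecreasing[OF that]) (metis S(1,5))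
  have Tmono: "T x \<le> T y" if "x \<le> y" for x y
    by (rule DERIV_nonneg_imp_nondecreasing[OF that]) (metis T(1,5))
  have bnn: "b x \<ge> 0" for x
  proof (cases "x \<le> R1")
    case True thus ?thesis using T(3)[of x] S(3)[of "min x (s/2)"] Smono[of "min x (s/2)" x] by (simp add: b_def)
  next
    case False thus ?thesis using S(4)[of x] T(4)[of "max x R2"] Tmono[of x "max x R2"] assms by (simp add: b_def)
  qed
  define G' where "G' r = (-1) * (r powr (-n/2) * b r)" for r
  define G'' where "G'' r = n/2 * (r powr (-n/2-1) * b r) - r powr (-n/2) * b' r" for r
  have sG': "smooth_real G'" unfolding G'_def
    by (rule smooth_real_mult[OF smooth_real_const smooth_real_powr_mult[OF sb, of "s/2"]])
       (use b0 assms in auto)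
  have dG': "(G' has_real_derivative G'' r) (at r)" for r
  proof (cases "r > 0")
    case True
    thus ?thesis unfolding G'_def G''_def by (auto intro!: derivative_eq_intros b simp: algebra_simps)
  next
    case False
    have "((\<lambda>x. 0) has_real_derivative G'' r) (at r)"
      using b0[of r] False assms by (simp add: G''_def)
    thus ?thesis
      by (rule DERIV_cong_ev[THEN iffD1, OF refl _ refl, rotated])
         (use False assms b0 in \<open>auto simp: G'_def intro!: eventually_nhds_in_open[of "{..<s/2}", THEN eventually_mono]\<close>)
  qed
  obtain F where F: "\<And>x. (F has_real_derivative G' x) (at x)"
    using real_antiderivative[OF smooth_real_continuous[OF sG']] by blast
  define G where "G r = F r - F R2" for r
  have dG: "(G has_real_derivative G' r) (at r)" for r
    unfolding G_def by (auto intro!: derivative_eq_intros F)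
  have G'np: "G' r \<le> 0" for r by (simp add: G'_def bnn)
  have anti: "G y \<le> G x" if "x \<le> y" for x y
    by (rule DERIV_nonpos_imp_nonincreasing[OF that]) (metis dG G'np)
  have G0: "G r = 0" if "r \<ge> R2" for r
  proof (cases "r = R2")
    case False
    hence "R2 < r" using that by simp
    then obtain z where "R2 < z" "G r - G R2 = (r - R2) * G' z"
      using MVT2[of R2 r G G'] dG by blast
    thus ?thesis using bR[of z] by (simp add: G'_def G_def)
  qed (simp add: G_def)
  have Gnn: "G r \<ge> 0" for r
    using anti[of r "max r R2"] G0[of "max r R2"] by simp
  have key: "4 * r * G'' r + 2 * n * G' r = - 4 * (r powr (1 - n/2) * b' r)" for r
  proof (cases "r > 0")
    case True
    have e: "r * r powr (-n/2) = r powr (1-n/2)" "r * r powr (-n/2-1) = r powr (-n/2)"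
      using True by (simp_all add: powr_mult_base)
    have "4 * r * G'' r + 2 * n * G' r = 2 * n * (r * r powr (-n/2-1)) * b r
        - 4 * (r * r powr (-n/2)) * b' r - 2 * n * (r powr (-n/2)) * b r"
      unfolding G''_def G'_def by (simp only: algebra_simps) simp
    thus ?thesis unfolding e by simp
  next
    case False thus ?thesis using b0[of r] assms by (simp add: G''_def G'_def)
  qed
  show ?thesis
  proof (rule that[of G G' G'', OF dG dG' smooth_realI[OF dG sG'] Gnn G0])
    fix r assume "r \<le> s"
    hence "b' r \<ge> 0" using T(7)[of r] S(5)[of r] assms by (simp add: b'_def)
    thus "4 * r * G'' r + 2 * n * G' r \<le> 0" unfolding key by simp
  next
    fix r assume "s \<le> r" "r \<le> R1"
    hence "b' r = 0" using T(7)[of r] S(6)[of r] by (simp add: b'_def)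
    thus "4 * r * G'' r + 2 * n * G' r = 0" unfolding key by simp
  next
    fix r assume "R1 < r" "r < R2"
    hence "b' r < 0" "r > 0" using T(6)[of r] S(6)[of r] assms by (simp_all add: b'_def)
    thus "4 * r * G'' r + 2 * n * G' r > 0" unfolding key by (simp add: mult_pos_neg)
  next
    fix r assume "R2 \<le> r"
    hence "b' r = 0" using T(7)[of r] S(6)[of r] assms by (simp add: b'_def)
    thus "4 * r * G'' r + 2 * n * G' r = 0" unfolding key by simp
  qed
qed

section \<open>Radial test functions\<close>

lemma partial_eqI: "(f has_derivative f') (at x) \<Longrightarrow> partial i f x = f' (axis i 1)"
  unfolding partial_def by (simp add: frechet_derivative_at[symmetric])

lemma Ck_on_Suc_D: "Ck_on (Suc k) S f \<Longrightarrow> Ck_on k S f"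
proof (induction k arbitrary: f)
  case 0
  thus ?case
    by (auto intro!: continuous_at_imp_continuous_on differentiable_imp_continuous_within)
next
  case (Suc k)
  have "\<forall>x\<in>S. f differentiable (at x)" "Ck_on (Suc k) S (partial i f)" for i
    using Suc.prems by (simp_all del: Ck_on.simps add: Ck_on.simps(2)[of "Suc k"])
  thus ?case using Suc.IH Ck_on.simps(2) by blast
qed

lemma Ck_on_const: "Ck_on k UNIV (\<lambda>x::real^'n::finite. a)"
proof (induction k arbitrary: a)
  case (Suc k)
  have "partial i (\<lambda>x. a) = (\<lambda>x. 0)" for i :: 'n
    by (rule ext, rule trans[OF partial_eqI[OF has_derivative_const]]) simp
  thus ?case using Suc.IH[of 0] by simp
qed simp

lemma Ck_on_add:
  "Ck_on k UNIV f \<Longrightarrow> Ck_on k UNIV g \<Longrightarrow> Ck_on k UNIV (\<lambda>x. f x + g x)"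
proof (induction k arbitrary: f g)
  case 0 thus ?case by (simp add: continuous_on_add)
next
  case (Suc k)
  have d: "(f has_derivative frechet_derivative f (at x)) (at x)"
       "(g has_derivative frechet_derivative g (at x)) (at x)" for x
    using Suc.prems by (simp_all add: frechet_derivative_works)
  have "partial i (\<lambda>x. f x + g x) = (\<lambda>x. partial i f x + partial i g x)" for i
    by (rule ext, rule trans[OF partial_eqI[OF has_derivative_add[OF d]]]) (simp add: partial_def)
  moreover have "Ck_on k UNIV (\<lambda>x. partial i f x + partial i g x)" for i
    using Suc.prems by (intro Suc.IH) auto
  ultimately show ?case using Suc.prems by (auto intro!: differentiable_add)
qed

lemma Ck_on_mult:
  "Ck_on k UNIV f \<Longrightarrow> Ck_on k UNIV g \<Longrightarrow> Ck_on k UNIV (\<lambda>x. f x * g x)"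
proof (induction k arbitrary: f g)
  case 0 thus ?case by (simp add: continuous_on_mult)
next
  case (Suc k)
  have d: "(f has_derivative frechet_derivative f (at x)) (at x)"
       "(g has_derivative frechet_derivative g (at x)) (at x)" for x
    using Suc.prems by (simp_all add: frechet_derivative_works)
  have "partial i (\<lambda>x. f x * g x) = (\<lambda>x. f x * partial i g x + partial i f x * g x)" for i
    by (rule ext, rule trans[OF partial_eqI[OF has_derivative_mult[OF d]]]) (simp add: partial_def)
  moreover have "Ck_on k UNIV (\<lambda>x. f x * partial i g x + partial i f x * g x)" for i
    using Suc.prems Ck_on_Suc_D[OF Suc.prems(1)] Ck_on_Suc_D[OF Suc.prems(2)]
    by (intro Ck_on_add Suc.IH) auto
  ultimately show ?case using Suc.prems by (auto intro!: differentiable_mult)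
qed

lemma Ck_on_coord: "Ck_on k UNIV (\<lambda>x. a * ((x - xc) $ j))"
proof (cases k)
  case (Suc m)
  have d: "((\<lambda>x. a * ((x - xc) $ j)) has_derivative (\<lambda>h. a * (h $ j))) (at x)" for x
    by (auto intro!: derivative_eq_intros bounded_linear_imp_has_derivative bounded_linear_vec_nth)
  have "partial i (\<lambda>x. a * ((x - xc) $ j)) = (\<lambda>x. a * (axis i 1 $ j))" for i
    by (rule ext) (rule partial_eqI[OF d])
  thus ?thesis using d Ck_on_const unfolding Suc by (auto simp: differentiable_def)
qed (auto intro!: continuous_intros)

lemma has_derivative_radial:
  fixes xc x :: "real^'n"
  assumes "\<And>r. (G has_real_derivative G' r) (at r)"
  shows "((\<lambda>x. G ((norm (x - xc))\<^sup>2)) has_derivative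
     (\<lambda>h. G' ((norm (x - xc))\<^sup>2) * (2 * ((x - xc) \<bullet> h)))) (at x)"
proof -
  have 1: "((\<lambda>x. (x - xc) \<bullet> (x - xc)) has_derivative (\<lambda>h. 2 * ((x - xc) \<bullet> h))) (at x)"
    by (auto intro!: derivative_eq_intros simp: inner_commute)
  have 2: "(G has_derivative (\<lambda>h. h * G' ((x - xc) \<bullet> (x - xc)))) (at ((x - xc) \<bullet> (x - xc)))"
    using assms[of "(x - xc) \<bullet> (x - xc)"] unfolding has_field_derivative_def
    by (simp add: mult.commute[of _ "G' _"])
  show ?thesis
    using has_derivative_compose[OF 1 2] by (simp add: power2_norm_eq_inner mult.commute)
qed

lemma partial_radial:
  fixes xc :: "real^'n"
  assumes "\<And>r. (G has_real_derivative G' r) (at r)"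
  shows "partial i (\<lambda>x. G ((norm (x - xc))\<^sup>2)) =
     (\<lambda>x. G' ((norm (x - xc))\<^sup>2) * (2 * ((x - xc) $ i)))"
  by (rule ext, rule trans[OF partial_eqI[OF has_derivative_radial[OF assms]]])
     (simp add: inner_axis)

lemma has_derivative_partial_radial:
  fixes xc :: "real^'n"
  assumes "\<And>r. (G has_real_derivative G' r) (at r)" "\<And>r. (G' has_real_derivative G'' r) (at r)"
  shows "(partial i (\<lambda>x. G ((norm (x - xc))\<^sup>2)) has_derivative
     (\<lambda>h. G' ((norm (x - xc))\<^sup>2) * (2 * (h $ i)) +
       G'' ((norm (x - xc))\<^sup>2) * (2 * ((x - xc) \<bullet> h)) * (2 * ((x - xc) $ i)))) (at x)"
proof -
  have "((\<lambda>x. 2 * ((x - xc) $ i)) has_derivative (\<lambda>h. 2 * (h $ i))) (at x)"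
    by (auto intro!: derivative_eq_intros bounded_linear_imp_has_derivative bounded_linear_vec_nth)
  from has_derivative_mult[OF has_derivative_radial[OF assms(2)] this]
  show ?thesis unfolding partial_radial[OF assms(1)] .
qed

lemma partial2_radial:
  fixes xc :: "real^'n"
  assumes "\<And>r. (G has_real_derivative G' r) (at r)" "\<And>r. (G' has_real_derivative G'' r) (at r)"
  shows "partial i (partial i (\<lambda>x. G ((norm (x - xc))\<^sup>2))) x =
     2 * G' ((norm (x - xc))\<^sup>2) + 4 * G'' ((norm (x - xc))\<^sup>2) * ((x - xc) $ i)\<^sup>2"
  by (rule trans[OF partial_eqI[OF has_derivative_partial_radial[OF assms]]])
     (simp add: inner_axis power2_eq_square algebra_simps)

lemma laplacian_radial:
  fixes xc :: "real^'n"
  assumes "\<And>r. (G has_real_derivative G' r) (at r)" "\<And>r. (G' has_real_derivative G'' r) (at r)"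
  shows "laplacian (\<lambda>x. G ((norm (x - xc))\<^sup>2)) x =
     4 * (norm (x - xc))\<^sup>2 * G'' ((norm (x - xc))\<^sup>2) + 2 * real CARD('n) * G' ((norm (x - xc))\<^sup>2)"
proof -
  have "(norm (x - xc))\<^sup>2 = (\<Sum>i\<in>UNIV. ((x - xc) $ i)\<^sup>2)"
    by (simp only: power2_norm_eq_inner inner_vec_def inner_real_def) (simp only: power2_eq_square)
  thus ?thesis
    unfolding laplacian_def partial2_radial[OF assms]
    by (simp add: sum.distrib sum_distrib_left algebra_simps)
qed

lemma Ck_on_radial:
  fixes xc :: "real^'n"
  shows "Ck_real k G \<Longrightarrow> Ck_on k UNIV (\<lambda>x. G ((norm (x - xc))\<^sup>2))"
proof (induction k arbitrary: G)
  case 0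
  hence "continuous_on UNIV G" by simp
  hence "continuous_on UNIV (\<lambda>x. G ((norm (x - xc))\<^sup>2))"
    by (rule continuous_on_compose2) (auto intro!: continuous_intros)
  thus ?case by simp
next
  case (Suc k)
  then obtain G' where d: "\<And>x. (G has_real_derivative G' x) (at x)" "Ck_real k G'"
    unfolding Ck_real.simps by (elim exE conjE) blast
  have "Ck_on k UNIV (\<lambda>x. G' ((norm (x - xc))\<^sup>2) * (2 * ((x - xc) $ i)))" for i
    by (rule Ck_on_mult[OF Suc.IH[OF d(2)] Ck_on_coord])
  moreover have "(\<lambda>x. G ((norm (x - xc))\<^sup>2)) differentiable (at x)" for x
    using has_derivative_radial[OF d(1)] unfolding differentiable_def by blast
  ultimately show ?case by (simp add: partial_radial[OF d(1)])
qed

lemma radial_test_function: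
  fixes xc :: "real^'n"
  assumes "smooth_real G" "\<And>r. G r \<ge> 0" "R > 0" "\<And>r. r \<ge> R\<^sup>2 \<Longrightarrow> G r = 0" "cball xc R \<subseteq> S"
  shows "(\<lambda>x. G ((norm (x - xc))\<^sup>2)) \<in> nonneg_test_functions S"
proof -
  have sub: "{x. G ((norm (x - xc))\<^sup>2) \<noteq> 0} \<subseteq> cball xc R"
  proof
    fix x assume "x \<in> {x. G ((norm (x - xc))\<^sup>2) \<noteq> 0}"
    hence "(norm (x - xc))\<^sup>2 < R\<^sup>2" using assms(4)[of "(norm (x - xc))\<^sup>2"] by fastforce
    hence "norm (x - xc) < R" using assms(3) power_less_imp_less_base by fastforce
    thus "x \<in> cball xc R" by (simp add: dist_norm norm_minus_commute)
  qed
  hence cl: "closure {x. G ((norm (x - xc))\<^sup>2) \<noteq> 0} \<subseteq> cball xc R"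
    by (simp add: closure_minimal)
  have "compact (closure {x. G ((norm (x - xc))\<^sup>2) \<noteq> 0})"
    using bounded_subset[OF bounded_cball cl] by (simp add: compact_eq_bounded_closed)
  moreover have "Ck_on k UNIV (\<lambda>x. G ((norm (x - xc))\<^sup>2))" for k
    using assms(1) by (intro Ck_on_radial) (simp add: smooth_real_def)
  ultimately show ?thesis unfolding nonneg_test_functions_def using cl assms(2,5) by auto
qed

section \<open>Integration by parts\<close>

lemma lborel_integral_translate:
  fixes f :: "'a::euclidean_space \<Rightarrow> real"
  assumes [measurable]: "f \<in> borel_measurable borel"
  shows "(LINT x|lborel. f (c + x)) = (LINT x|lborel. f x)"
proof -
  have "(LINT x|lborel. f x) = (LINT x|distr lborel borel ((+) c). f x)"
    by (simp add: lborel_distr_plus)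
  also have "\<dots> = (LINT x|lborel. f (c + x))" by (rule integral_distr) auto
  finally show ?thesis by simp
qed

lemma integrable_continuous_compact_support:
  fixes f :: "'a::euclidean_space \<Rightarrow> real"
  assumes "continuous_on UNIV f" "\<And>x. x \<notin> cball xc R \<Longrightarrow> f x = 0"
  shows "integrable lborel f"
proof -
  have "integrable lborel (\<lambda>x. indicator (cball xc R) x *\<^sub>R f x)"
    by (rule borel_integrable_compact) (auto intro: continuous_on_subset[OF assms(1)])
  moreover have "(\<lambda>x. indicator (cball xc R) x *\<^sub>R f x) = f"
    by (rule ext) (use assms(2) in \<open>force simp: indicator_def simp del: mem_cball\<close>)
  ultimately show ?thesis by simp
qed

text \<open>By translation invariance the difference quotients of \<open>F\<close> have integral zero; the mean value
  theorem bounds them uniformly on a fixed ball, so dominated convergence passes to the derivative.\<close>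

lemma integral_directional_derivative_eq_0:
  fixes F F' :: "'a::euclidean_space \<Rightarrow> real"
  assumes "continuous_on UNIV F'"
    and d: "\<And>x. ((\<lambda>t. F (x + t *\<^sub>R e)) has_real_derivative F' x) (at 0)"
    and F: "continuous_on UNIV F"
    and supp: "\<And>x. x \<notin> cball xc R \<Longrightarrow> F x = 0" "\<And>x. x \<notin> cball xc R \<Longrightarrow> F' x = 0"
  shows "(LINT x|lborel. F' x) = 0"
proof -
  have intF: "integrable lborel F" using integrable_continuous_compact_support F supp by blast
  have [measurable]: "F \<in> borel_measurable borel" "F' \<in> borel_measurable borel"
    using assms(1) F by (auto intro: borel_measurable_continuous_onI)
  have dd: "((\<lambda>t. F (x + t *\<^sub>R e)) has_real_derivative F' (x + t *\<^sub>R e)) (at t)" for x t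
  proof -
    have "((\<lambda>s. F ((x + t *\<^sub>R e) + s *\<^sub>R e)) has_real_derivative F' (x + t *\<^sub>R e)) (at (t - t))"
      using d[of "x + t *\<^sub>R e"] by simp
    hence "((\<lambda>s. F ((x + t *\<^sub>R e) + (s - t) *\<^sub>R e)) has_real_derivative F' (x + t *\<^sub>R e)) (at t)"
      using DERIV_shift[of "\<lambda>s. F ((x + t *\<^sub>R e) + s *\<^sub>R e)" "F' (x + t *\<^sub>R e)" t "-t"] by simp
    thus ?thesis by (simp add: algebra_simps)
  qed
  have "compact (F' ` cball xc R)"
    by (intro compact_continuous_image continuous_on_subset[OF assms(1)]) auto
  then obtain M where M: "\<And>x. x \<in> cball xc R \<Longrightarrow> \<bar>F' x\<bar> \<le> M"
    using compact_imp_bounded bounded_real by (metis (no_types, lifting) image_eqI)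
  define B where "B = max M 0"
  have B: "\<bar>F' x\<bar> \<le> B" for x using M[of x] supp(2)[of x] by (cases "x \<in> cball xc R") (auto simp: B_def)
  define t where "t n = inverse (real (Suc n))" for n
  have t: "0 < t n" "t n \<le> 1" for n by (auto simp: t_def field_simps)
  have t0: "t \<longlonglongrightarrow> 0" unfolding t_def by (rule LIMSEQ_inverse_real_of_nat)
  define q where "q n x = (F (t n *\<^sub>R e + x) - F x) / t n" for n x
  have q0: "(LINT x|lborel. q n x) = 0" for n
  proof -
    have "integrable lborel (\<lambda>x. F (t n *\<^sub>R e + x))"
    proof (rule integrable_continuous_compact_support[where xc="xc - t n *\<^sub>R e" and R=R])
      show "continuous_on UNIV (\<lambda>x. F (t n *\<^sub>R e + x))"
        by (rule continuous_on_compose2[OF F]) (auto intro!: continuous_intros)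
      show "F (t n *\<^sub>R e + x) = 0" if "x \<notin> cball (xc - t n *\<^sub>R e) R" for x
        using that by (intro supp(1)) (auto simp: dist_norm algebra_simps)
    qed
    thus ?thesis unfolding q_def using intF lborel_integral_translate[of F "t n *\<^sub>R e"] by simp
  qed
  have lim: "(\<lambda>n. q n x) \<longlonglongrightarrow> F' x" for x
  proof -
    have "((\<lambda>h. (F (x + (0 + h) *\<^sub>R e) - F (x + 0 *\<^sub>R e)) / h) \<longlongrightarrow> F' x) (at 0)"
      using d[of x] by (simp only: DERIV_def)
    moreover have "filterlim t (at 0) sequentially"
      using t0 t(1) by (auto simp: filterlim_at intro!: always_eventually) (metis less_irrefl)
    ultimately have "((\<lambda>n. (F (x + (0 + t n) *\<^sub>R e) - F (x + 0 *\<^sub>R e)) / t n) \<longlongrightarrow> F' x) sequentially"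
      by (rule filterlim_compose)
    thus ?thesis by (simp add: q_def add.commute)
  qed
  have bound: "norm (q n x) \<le> indicator (cball xc (\<bar>R\<bar> + norm e)) x * B" for n x
  proof (cases "x \<in> cball xc (\<bar>R\<bar> + norm e)")
    case True
    obtain z where "F (x + t n *\<^sub>R e) - F (x + 0 *\<^sub>R e) = (t n - 0) * F' (x + z *\<^sub>R e)"
      using MVT2[of 0 "t n" "\<lambda>s. F (x + s *\<^sub>R e)" "\<lambda>s. F' (x + s *\<^sub>R e)"] t(1)[of n] dd by blast
    hence "q n x = F' (x + z *\<^sub>R e)" using t(1)[of n] by (simp add: q_def add.commute)
    thus ?thesis using True B by simp
  next
    case False
    hence far: "dist xc x > \<bar>R\<bar> + norm e" by simp
    have "norm (t n *\<^sub>R e) \<le> norm e" using t[of n] mult_left_le_one_le[of "norm e" "t n"] by simp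
    moreover have "dist xc x \<le> dist xc (t n *\<^sub>R e + x) + norm (t n *\<^sub>R e)"
      using dist_triangle[of xc x "t n *\<^sub>R e + x"] by (simp add: dist_norm)
    ultimately have "dist xc (t n *\<^sub>R e + x) > R" using far by linarith
    hence "F (t n *\<^sub>R e + x) = 0" by (intro supp) simp
    moreover have "F x = 0" using far norm_ge_zero[of e] by (intro supp) (auto simp del: norm_ge_zero)
    ultimately show ?thesis using False by (simp add: q_def)
  qed
  have "(\<lambda>n. LINT x|lborel. q n x) \<longlonglongrightarrow> (LINT x|lborel. F' x)"
  proof (rule integral_dominated_convergence[where w="\<lambda>x. indicator (cball xc (\<bar>R\<bar> + norm e)) x * B"])
    show "integrable lborel (\<lambda>x. indicator (cball xc (\<bar>R\<bar> + norm e)) x * B)"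
      by (intro integrable_mult_left integrable_real_indicator) (auto simp: emeasure_bounded_finite[unfolded infinity_ennreal_def])
    show "q n \<in> borel_measurable lborel" for n unfolding q_def by measurable
  qed (use lim bound in auto)
  thus ?thesis unfolding q0 using LIMSEQ_unique tendsto_const by blast
qed

lemma continuous_on_extend_by_0:
  fixes g :: "'a::metric_space \<Rightarrow> real"
  assumes S: "open S" "cball xc R \<subseteq> S"
    and "continuous_on S g" "\<And>x. x \<in> S \<Longrightarrow> x \<notin> cball xc R \<Longrightarrow> g x = 0"
  shows "continuous_on UNIV (\<lambda>x. if x \<in> S then g x else 0)"
proof -
  have "open (- cball xc R)" by (rule open_Compl) simp
  hence "continuous_on (S \<union> - cball xc R) (\<lambda>x. if x \<in> S then g x else 0)"
    using assms by (intro continuous_on_cases_local_open) (auto intro!: open_subset)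
  moreover have "S \<union> - cball xc R = UNIV" using S by auto
  ultimately show ?thesis by simp
qed

text \<open>Each summand \<open>Q \<partial>\<^sub>i\<^sub>i\<eta> - \<eta> \<partial>\<^sub>i\<^sub>iQ\<close> is the derivative of \<open>Q \<partial>\<^sub>i\<eta> - \<eta> \<partial>\<^sub>iQ\<close> in the direction of
  the \<open>i\<close>-th axis. The functions \<open>Q\<close>, \<open>Q1\<close>, \<open>Q2\<close> may be singular outside \<open>S\<close>, where \<open>\<eta>\<close>
  vanishes; this is needed for the logarithmic barrier used later.\<close>

lemma integral_green:
  fixes Q \<eta> :: "real^'n \<Rightarrow> real" and Q1 Q2 E1 E2 :: "'n \<Rightarrow> real^'n \<Rightarrow> real"
  assumes S: "open S" "cball xc R \<subseteq> S"
    and Q1: "\<And>i x. x \<in> S \<Longrightarrow> ((\<lambda>t. Q (x + t *\<^sub>R axis i 1)) has_real_derivative Q1 i x) (at 0)"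
    and Q2: "\<And>i x. x \<in> S \<Longrightarrow> ((\<lambda>t. Q1 i (x + t *\<^sub>R axis i 1)) has_real_derivative Q2 i x) (at 0)"
    and E1: "\<And>i x. ((\<lambda>t. \<eta> (x + t *\<^sub>R axis i 1)) has_real_derivative E1 i x) (at 0)"
    and E2: "\<And>i x. ((\<lambda>t. E1 i (x + t *\<^sub>R axis i 1)) has_real_derivative E2 i x) (at 0)"
    and cQ: "continuous_on S Q" "\<And>i. continuous_on S (Q1 i)" "\<And>i. continuous_on S (Q2 i)"
    and cE: "continuous_on UNIV \<eta>" "\<And>i. continuous_on UNIV (E1 i)" "\<And>i. continuous_on UNIV (E2 i)"
    and supp: "\<And>x. x \<notin> cball xc R \<Longrightarrow> \<eta> x = 0"
  shows "(LINT x|lborel. indicator S x * (Q x * (\<Sum>i\<in>UNIV. E2 i x) - \<eta> x * (\<Sum>i\<in>UNIV. Q2 i x))) = 0"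
proof -
  have opn: "open (- cball xc R)" by (rule open_Compl) simp
  have ev: "\<forall>\<^sub>F t in nhds 0. x + t *\<^sub>R e \<in> T" if "open T" "x \<in> T" for T :: "(real^'n) set" and x e
  proof -
    have "((\<lambda>t. x + t *\<^sub>R e) \<longlongrightarrow> x + 0 *\<^sub>R e) (nhds 0)"
      by (intro tendsto_intros filterlim_ident)
    thus ?thesis using that topological_tendstoD by fastforce
  qed
  have loc0: "g' = 0" if "\<And>y. y \<notin> cball xc R \<Longrightarrow> g y = 0" "x \<notin> cball xc R"
     "((\<lambda>t. g (x + t *\<^sub>R e)) has_real_derivative g') (at 0)" for g :: "real^'n \<Rightarrow> real" and g' x e
  proof -
    have "\<forall>\<^sub>F t in nhds 0. g (x + t *\<^sub>R e) = 0"
      using ev[OF opn, of x e] that(1,2) by (auto elim!: eventually_mono)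
    hence "((\<lambda>t. 0) has_real_derivative g') (at 0)"
      using that(3) DERIV_cong_ev[OF refl _ refl] by fastforce
    thus ?thesis using DERIV_const DERIV_unique by blast
  qed
  have E1s: "E1 i x = 0" if "x \<notin> cball xc R" for i x using loc0[OF supp that E1] .
  have E2s: "E2 i x = 0" if "x \<notin> cball xc R" for i x using loc0[OF E1s that E2] .
  define F where "F i x = (if x \<in> S then Q x * E1 i x - \<eta> x * Q1 i x else 0)" for i x
  define F' where "F' i x = (if x \<in> S then Q x * E2 i x - \<eta> x * Q2 i x else 0)" for i x
  note cont = continuous_on_extend_by_0[OF S]
  have "(LINT x|lborel. F' i x) = 0" for i
  proof (rule integral_directional_derivative_eq_0[where xc=xc and R=R and F="F i" and e="axis i 1"])
    show "continuous_on UNIV (F' i)" unfolding F'_def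
      by (rule cont) (auto intro!: continuous_intros cQ continuous_on_subset[OF cE(1)]
         continuous_on_subset[OF cE(3)] simp: supp E2s)
    show "continuous_on UNIV (F i)" unfolding F_def
      by (rule cont) (auto intro!: continuous_intros cQ continuous_on_subset[OF cE(1)]
         continuous_on_subset[OF cE(2)] simp: supp E1s)
    show "F i x = 0" "F' i x = 0" if "x \<notin> cball xc R" for x
      using that by (simp_all add: F_def F'_def supp E1s E2s del: mem_cball)
    fix x
    show "((\<lambda>t. F i (x + t *\<^sub>R axis i 1)) has_real_derivative F' i x) (at 0)"
    proof (cases "x \<in> S")
      case True
      have "((\<lambda>t. Q (x + t *\<^sub>R axis i 1) * E1 i (x + t *\<^sub>R axis i 1) -
          \<eta> (x + t *\<^sub>R axis i 1) * Q1 i (x + t *\<^sub>R axis i 1)) has_real_derivative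
         (Q1 i x * E1 i (x + 0 *\<^sub>R axis i 1) + E2 i x * Q (x + 0 *\<^sub>R axis i 1)) -
         (E1 i x * Q1 i (x + 0 *\<^sub>R axis i 1) + Q2 i x * \<eta> (x + 0 *\<^sub>R axis i 1))) (at 0)"
        by (intro DERIV_diff DERIV_mult Q1 Q2 E1 E2 True)
      hence "((\<lambda>t. Q (x + t *\<^sub>R axis i 1) * E1 i (x + t *\<^sub>R axis i 1) -
          \<eta> (x + t *\<^sub>R axis i 1) * Q1 i (x + t *\<^sub>R axis i 1)) has_real_derivative F' i x) (at 0)"
        using True by (simp add: F'_def algebra_simps)
      thus ?thesis
        by (rule DERIV_cong_ev[THEN iffD1, OF refl _ refl, rotated])
           (use ev[OF S(1) True, of "axis i 1"] in \<open>auto simp: F_def elim!: eventually_mono\<close>)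
    next
      case False
      hence out: "x \<notin> cball xc R" using S by auto
      hence "((\<lambda>t. 0) has_real_derivative F' i x) (at 0)" using False by (simp add: F'_def)
      thus ?thesis
        by (rule DERIV_cong_ev[THEN iffD1, OF refl _ refl, rotated])
           (use ev[OF opn, of x "axis i 1"] out in
             \<open>auto simp: F_def supp E1s simp del: mem_cball elim!: eventually_mono\<close>)
    qed
  qed
  moreover have "integrable lborel (F' i)" for i
  proof (rule integrable_continuous_compact_support[where xc=xc and R=R])
    show "continuous_on UNIV (F' i)" unfolding F'_def
      by (rule cont) (auto intro!: continuous_intros cQ continuous_on_subset[OF cE(1)]
         continuous_on_subset[OF cE(3)] simp: supp E2s)
  qed (simp add: F'_def supp E2s del: mem_cball)
  ultimately have "(LINT x|lborel. (\<Sum>i\<in>UNIV. F' i x)) = 0"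
    by (subst Bochner_Integration.integral_sum) auto
  also have "(\<lambda>x. \<Sum>i\<in>UNIV. F' i x) =
      (\<lambda>x. indicator S x * (Q x * (\<Sum>i\<in>UNIV. E2 i x) - \<eta> x * (\<Sum>i\<in>UNIV. Q2 i x)))"
    by (rule ext) (auto simp: F'_def sum_subtractf sum_distrib_left indicator_def)
  finally show ?thesis .
qed

section \<open>Touching from below\<close>

lemma has_derivative_imp_directional:
  fixes f :: "'a::real_normed_vector \<Rightarrow> real"
  assumes "(f has_derivative f') (at x)"
  shows "((\<lambda>t. f (x + t *\<^sub>R e)) has_real_derivative f' e) (at 0)"
proof -
  have "((\<lambda>t::real. x + t *\<^sub>R e) has_derivative (\<lambda>t. t *\<^sub>R e)) (at 0)"
    by (auto intro!: derivative_eq_intros)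
  moreover have "(f has_derivative f') (at (x + 0 *\<^sub>R e))" using assms by simp
  ultimately have "((\<lambda>t. f (x + t *\<^sub>R e)) has_derivative (\<lambda>t. f' (t *\<^sub>R e))) (at 0)"
    by (rule has_derivative_compose)
  moreover have "(\<lambda>t. f' (t *\<^sub>R e)) = (*) (f' e)"
    using assms linear_scale[OF has_derivative_linear[OF assms]] by (auto simp: mult.commute)
  ultimately show ?thesis by (simp add: has_field_derivative_def)
qed

lemma integral_pos_of_continuous:
  fixes f :: "'a::euclidean_space \<Rightarrow> real"
  assumes "continuous_on UNIV f" "\<And>x. f x \<ge> 0" "integrable lborel f" "f y > 0"
  shows "(LINT x|lborel. f x) > 0"
proof -
  have "\<forall>\<^sub>F x in at y. f x > f y / 2"
    using assms(1,4) by (intro order_tendstoD(1)[of f "f y"])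
      (auto simp: continuous_on_eq_continuous_at isCont_def)
  then obtain d where d: "d > 0" "\<And>x. x \<noteq> y \<Longrightarrow> dist x y < d \<Longrightarrow> f x > f y / 2"
    unfolding eventually_at by blast
  have "0 < (f y / 2) * measure lborel (ball y d)" using content_ball_pos[OF d(1)] assms(4) by simp
  also have "\<dots> = (LINT x|lborel. (f y / 2) * indicator (ball y d) x)" by simp
  also have "\<dots> \<le> (LINT x|lborel. f x)"
  proof (rule integral_mono)
    show "integrable lborel (\<lambda>x. (f y / 2) * indicator (ball y d) x)"
      by (intro integrable_mult_right integrable_real_indicator) (auto simp: emeasure_bounded_finite[unfolded infinity_ennreal_def])
    show "(f y / 2) * indicator (ball y d) x \<le> f x" for x
      using d(2)[of x] assms(2)[of x] assms(4)
      by (cases "x = y") (auto simp: indicator_def dist_commute intro: less_imp_le)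
  qed fact
  finally show ?thesis .
qed

text \<open>The difference \<open>f = u - Q\<close> satisfies \<open>\<integral> f \<Delta>\<eta> \<le> 0\<close> for every nonnegative test function. If \<open>f\<close>
  had a strict minimum \<open>m\<close> at the centre, then \<open>f\<close> would exceed \<open>m + \<gamma>\<close> on a shell and stay below
  \<open>m + \<gamma>/2\<close> on a small ball. For the radial \<open>\<eta>\<close> with \<open>\<Delta>\<eta>\<close> negative only on that ball and
  positive only on that shell, \<open>(f - m - \<gamma>/2) \<Delta>\<eta>\<close> is nonnegative and somewhere positive, while
  its integral is at most zero because constants integrate to zero against \<open>\<Delta>\<eta>\<close>.\<close>

lemma distr_superharmonic_no_strict_touching:
  fixes u Q :: "real^'n \<Rightarrow> real" and Q1 Q2 :: "'n \<Rightarrow> real^'n \<Rightarrow> real"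
  assumes S: "open S" "cball xc R \<subseteq> S" and R: "R > 0"
    and u: "continuous_on S u" "distr_laplacian_nonpos_on S u"
    and Q1: "\<And>i x. x \<in> S \<Longrightarrow> ((\<lambda>t. Q (x + t *\<^sub>R axis i 1)) has_real_derivative Q1 i x) (at 0)"
    and Q2: "\<And>i x. x \<in> S \<Longrightarrow> ((\<lambda>t. Q1 i (x + t *\<^sub>R axis i 1)) has_real_derivative Q2 i x) (at 0)"
    and cQ: "continuous_on S Q" "\<And>i. continuous_on S (Q1 i)" "\<And>i. continuous_on S (Q2 i)"
    and sub: "\<And>x. x \<in> cball xc R \<Longrightarrow> (\<Sum>i\<in>UNIV. Q2 i x) \<ge> 0"
    and strict: "\<And>x. x \<in> cball xc R \<Longrightarrow> x \<noteq> xc \<Longrightarrow> u x - Q x > u xc - Q xc"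
  shows False
proof -
  define m where "m = u xc - Q xc"
  define A where "A = cball xc R - ball xc (R/2)"
  have "compact A" unfolding A_def by (intro compact_diff) auto
  have cuQ: "continuous_on S (\<lambda>x. u x - Q x)" by (intro continuous_intros u cQ)
  obtain \<gamma> where g: "\<gamma> > 0" "\<And>x. x \<in> A \<Longrightarrow> u x - Q x \<ge> m + \<gamma>"
  proof (cases "A = {}")
    case True thus ?thesis using that[of 1] by simp
  next
    case False
    have "continuous_on A (\<lambda>x. u x - Q x)"
      by (rule continuous_on_subset[OF cuQ]) (use S in \<open>auto simp: A_def\<close>)
    then obtain z where z: "z \<in> A" "\<And>x. x \<in> A \<Longrightarrow> u z - Q z \<le> u x - Q x"
      using continuous_attains_inf[OF \<open>compact A\<close> False] by blast
    have "u z - Q z > m" unfolding m_def using z(1) R by (intro strict) (auto simp: A_def)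
    thus ?thesis using that[of "u z - Q z - m"] z(2) by simp
  qed
  have "xc \<in> S" using S R by auto
  have "isCont (\<lambda>x. u x - Q x) xc" using cuQ S(1) \<open>xc \<in> S\<close> continuous_on_eq_continuous_at by blast
  hence "\<forall>\<^sub>F x in at xc. u x - Q x < m + \<gamma>/2"
    by (intro order_tendstoD(2)[of "\<lambda>x. u x - Q x" m]) (use g in \<open>auto simp: isCont_def m_def\<close>)
  then obtain d where d: "d > 0" "\<And>x. x \<noteq> xc \<Longrightarrow> dist x xc < d \<Longrightarrow> u x - Q x < m + \<gamma>/2"
    unfolding eventually_at by blast
  define s where "s = min (d\<^sup>2/2) (R\<^sup>2/8)"
  have s: "0 < s" "s < R\<^sup>2/4" "R\<^sup>2/4 < R\<^sup>2" "s < d\<^sup>2"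
    unfolding s_def using zero_less_power[OF d(1), of 2] zero_less_power[OF R, of 2] by linarith+
  obtain G G' G'' where
    G: "\<And>r. (G has_real_derivative G' r) (at r)" "\<And>r. (G' has_real_derivative G'' r) (at r)"
    "smooth_real G" "\<And>r. G r \<ge> 0" "\<And>r. r \<ge> R\<^sup>2 \<Longrightarrow> G r = 0"
    "\<And>r. r \<le> s \<Longrightarrow> 4 * r * G'' r + 2 * real CARD('n) * G' r \<le> 0"
    "\<And>r. s \<le> r \<Longrightarrow> r \<le> R\<^sup>2/4 \<Longrightarrow> 4 * r * G'' r + 2 * real CARD('n) * G' r = 0"
    "\<And>r. R\<^sup>2/4 < r \<Longrightarrow> r < R\<^sup>2 \<Longrightarrow> 4 * r * G'' r + 2 * real CARD('n) * G' r > 0"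
    "\<And>r. R\<^sup>2 \<le> r \<Longrightarrow> 4 * r * G'' r + 2 * real CARD('n) * G' r = 0"
    using radial_profile[OF s(1,2,3), of "real CARD('n)"] by blast
  define \<eta> where "\<eta> x = G ((norm (x - xc))\<^sup>2)" for x
  define D where "D x = laplacian \<eta> x" for x
  have Deq: "D x = 4 * (norm (x - xc))\<^sup>2 * G'' ((norm (x - xc))\<^sup>2) + 2 * real CARD('n) * G' ((norm (x - xc))\<^sup>2)" for x
    unfolding D_def \<eta>_def by (rule laplacian_radial[OF G(1,2)])
  have smG': "smooth_real G'" by (rule smooth_real_deriv[OF G(3,1)])
  have smG'': "smooth_real G''" by (rule smooth_real_deriv[OF smG' G(2)])
  have cGs: "continuous_on UNIV (\<lambda>x. H ((norm (x - xc))\<^sup>2))" if "smooth_real H" for H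
    by (rule continuous_on_compose2[OF smooth_real_continuous[OF that]]) (auto intro!: continuous_intros)
  note cG = cGs[OF G(3)] cGs[OF smG'] cGs[OF smG'']
  have cD: "continuous_on UNIV D" unfolding Deq by (intro continuous_intros cG)
  have "\<eta> \<in> nonneg_test_functions S"
    unfolding \<eta>_def by (rule radial_test_function[OF G(3,4) R G(5) S(2)])
  hence neg: "(LINT x|lborel. indicator S x *\<^sub>R (u x * D x)) \<le> 0"
    using u(2) unfolding distr_laplacian_nonpos_on_def set_lebesgue_integral_def D_def by blast
  define E1 where "E1 i x = partial i \<eta> x" for i x
  define E2 where "E2 i x = partial i (partial i \<eta>) x" for i x
  have E1eq: "E1 i x = G' ((norm (x - xc))\<^sup>2) * (2 * ((x - xc) $ i))" for i x
    unfolding E1_def \<eta>_def partial_radial[OF G(1)] ..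
  have E2eq: "E2 i x = 2 * G' ((norm (x - xc))\<^sup>2) + 4 * G'' ((norm (x - xc))\<^sup>2) * ((x - xc) $ i)\<^sup>2" for i x
    unfolding E2_def \<eta>_def by (rule partial2_radial[OF G(1,2)])
  have dE1: "((\<lambda>t. \<eta> (x + t *\<^sub>R axis i 1)) has_real_derivative E1 i x) (at 0)" for i x
    using has_derivative_imp_directional[OF has_derivative_radial[OF G(1), of xc x], of "axis i 1"]
    unfolding E1eq \<eta>_def by (simp add: inner_axis)
  have dE2: "((\<lambda>t. E1 i (x + t *\<^sub>R axis i 1)) has_real_derivative E2 i x) (at 0)" for i x
    using has_derivative_imp_directional[OF has_derivative_partial_radial[OF G(1,2), of i xc x], of "axis i 1"]
    unfolding E2eq E1_def \<eta>_def by (simp add: inner_axis power2_eq_square algebra_simps)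
  have sumE2: "(\<Sum>i\<in>UNIV. E2 i x) = D x" for x
    unfolding E2_def D_def laplacian_def ..
  have cE: "continuous_on UNIV \<eta>" "continuous_on UNIV (E1 i)" "continuous_on UNIV (E2 i)" for i
    unfolding E1eq E2eq \<eta>_def by (intro continuous_intros cG)+
  have out: "(norm (x - xc))\<^sup>2 > R\<^sup>2" if "x \<notin> cball xc R" for x
    using that R by (intro power_strict_mono) (auto simp: dist_norm norm_minus_commute)
  have \<eta>0: "\<eta> x = 0" if "x \<notin> cball xc R" for x
    using G(5)[OF less_imp_le[OF out[OF that]]] by (simp add: \<eta>_def)
  have D0: "D x = 0" if "x \<notin> cball xc R" for x
    unfolding Deq using G(9)[OF less_imp_le[OF out[OF that]]] .
  define m' where "m' = m + \<gamma>/2"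
  have green: "(LINT x|lborel. indicator S x * ((Q x + m') * (\<Sum>i\<in>UNIV. E2 i x) - \<eta> x * (\<Sum>i\<in>UNIV. Q2 i x))) = 0"
  proof (rule integral_green[OF S, where ?Q1.0=Q1 and ?E1.0=E1])
    show "((\<lambda>t. Q (x + t *\<^sub>R axis i 1) + m') has_real_derivative Q1 i x) (at 0)" if "x \<in> S" for i x
      using DERIV_add[OF Q1[OF that] DERIV_const[of m']] by simp
  qed (use Q2 dE1 dE2 cE cQ \<eta>0 in \<open>auto intro!: continuous_intros simp del: mem_cball\<close>)
  have int: "integrable lborel (\<lambda>x. if x \<in> S then g x else 0)"
    and cont: "continuous_on UNIV (\<lambda>x. if x \<in> S then g x else 0)"
    if "continuous_on S g" "\<And>x. x \<notin> cball xc R \<Longrightarrow> g x = 0" for g :: "real^'n \<Rightarrow> real"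
  proof -
    show c: "continuous_on UNIV (\<lambda>x. if x \<in> S then g x else 0)"
      by (rule continuous_on_extend_by_0[OF S that(1)]) (use that in blast)
    show "integrable lborel (\<lambda>x. if x \<in> S then g x else 0)"
      by (rule integrable_continuous_compact_support[OF c, of xc R]) (use that in \<open>simp del: mem_cball\<close>)
  qed
  have cDS: "continuous_on S D" and c\<eta>S: "continuous_on S \<eta>"
    using cD cE(1) continuous_on_subset by blast+
  define w where "w x = (if x \<in> S then (u x - (Q x + m')) * D x else 0)" for x
  have wnn: "w x \<ge> 0" for x
  proof (cases "x \<in> cball xc R")
    case True
    hence "x \<in> S" using S by auto
    consider "(norm (x - xc))\<^sup>2 \<le> s" | "s \<le> (norm (x - xc))\<^sup>2" "(norm (x - xc))\<^sup>2 \<le> R\<^sup>2/4"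
      | "(norm (x - xc))\<^sup>2 > R\<^sup>2/4" by linarith
    thus ?thesis
    proof cases
      case 1
      hence "norm (x - xc) < d" using s(4) d(1)
        by (meson le_less_trans less_eq_real_def power_less_imp_less_base)
      hence "u x - (Q x + m') \<le> 0"
        using d(2)[of x] g(1) by (cases "x = xc") (auto simp: m'_def m_def dist_norm)
      moreover have "D x \<le> 0" unfolding Deq using G(6)[OF 1] .
      ultimately show ?thesis by (simp add: w_def mult_nonpos_nonpos)
    next
      case 2
      have "D x = 0" unfolding Deq using G(7)[OF 2] .
      thus ?thesis by (simp add: w_def)
    next
      case 3
      have "(R/2)\<^sup>2 < (norm (x - xc))\<^sup>2" using 3 by (simp add: power_divide)
      hence "norm (x - xc) > R/2" by (rule power_less_imp_less_base) simp
      hence "x \<in> A" using True by (simp add: A_def dist_norm norm_minus_commute)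
      hence "u x - (Q x + m') \<ge> 0" using g by (auto simp: m'_def dest!: g(2))
      moreover have "D x \<ge> 0"
      proof (cases "(norm (x - xc))\<^sup>2 < R\<^sup>2")
        case True thus ?thesis unfolding Deq using G(8)[OF 3] by simp
      next
        case False
        thus ?thesis unfolding Deq using G(9)[of "(norm (x - xc))\<^sup>2"] by simp
      qed
      ultimately show ?thesis by (simp add: w_def)
    qed
  qed (simp add: w_def D0 del: mem_cball)
  have wc: "continuous_on UNIV w" and wi: "integrable lborel w"
    unfolding w_def using D0 by (intro cont int; auto intro!: continuous_intros u cQ cDS simp del: mem_cball)+
  have "\<exists>y. w y > 0"
  proof -
    define y where "y = xc + (3/4 * R) *\<^sub>R axis undefined 1"
    have ny: "norm (y - xc) = 3/4 * R" using R by (simp add: y_def)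
    have "y \<in> A" using ny R by (simp add: A_def dist_norm norm_minus_commute)
    hence "u y - (Q y + m') > 0" using g by (auto simp: m'_def dest!: g(2))
    moreover have "D y > 0" unfolding Deq
    proof (rule G(8))
      have "(norm (y - xc))\<^sup>2 = 9/16 * R\<^sup>2"
        by (simp only: ny) (simp add: power_mult_distrib power_divide)
      thus "R\<^sup>2/4 < (norm (y - xc))\<^sup>2" "(norm (y - xc))\<^sup>2 < R\<^sup>2"
        using zero_less_power[OF R, of 2] by linarith+
    qed
    moreover have "y \<in> S" using \<open>y \<in> A\<close> S by (auto simp: A_def)
    ultimately show ?thesis by (intro exI[of _ y]) (simp add: w_def)
  qed
  then obtain y where "w y > 0" ..
  have pos: "(LINT x|lborel. w x) > 0" by (rule integral_pos_of_continuous[OF wc wnn wi]) fact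
  define w1 where "w1 x = (if x \<in> S then u x * D x else 0)" for x
  define w2 where "w2 x = (if x \<in> S then (Q x + m') * D x - \<eta> x * (\<Sum>i\<in>UNIV. Q2 i x) else 0)" for x
  define w3 where "w3 x = (if x \<in> S then \<eta> x * (\<Sum>i\<in>UNIV. Q2 i x) else 0)" for x
  have i1: "integrable lborel w1" unfolding w1_def
    by (rule int) (use D0 in \<open>auto intro!: continuous_intros u cDS simp del: mem_cball\<close>)
  have i2: "integrable lborel w2" unfolding w2_def
    by (rule int) (use D0 \<eta>0 in \<open>auto intro!: continuous_intros cQ cDS c\<eta>S simp del: mem_cball\<close>)
  have i3: "integrable lborel w3" unfolding w3_def
    by (rule int) (use \<eta>0 in \<open>auto intro!: continuous_intros cQ c\<eta>S simp del: mem_cball\<close>)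
  have "w3 x \<ge> 0" for x
    using sub[of x] \<eta>0[of x] G(4) by (cases "x \<in> cball xc R") (auto simp: w3_def \<eta>_def simp del: mem_cball)
  hence p3: "(LINT x|lborel. w3 x) \<ge> 0" by (rule Bochner_Integration.integral_nonneg)
  have "(LINT x|lborel. w1 x) = (LINT x|lborel. indicator S x *\<^sub>R (u x * D x))"
    by (rule Bochner_Integration.integral_cong) (auto simp: w1_def indicator_def)
  hence p1: "(LINT x|lborel. w1 x) \<le> 0" using neg by simp
  have "(LINT x|lborel. w2 x) =
     (LINT x|lborel. indicator S x * ((Q x + m') * (\<Sum>i\<in>UNIV. E2 i x) - \<eta> x * (\<Sum>i\<in>UNIV. Q2 i x)))"
    by (rule Bochner_Integration.integral_cong) (auto simp: w2_def indicator_def sumE2)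
  hence p2: "(LINT x|lborel. w2 x) = 0" using green by simp
  have "w x = w1 x - w2 x - w3 x" for x by (simp add: w_def w1_def w2_def w3_def algebra_simps)
  hence "(LINT x|lborel. w x) = (LINT x|lborel. w1 x) - (LINT x|lborel. w2 x) - (LINT x|lborel. w3 x)"
    using i1 i2 i3 by simp
  thus False using p1 p2 p3 pos by simp
qed

text \<open>Subtracting a small multiple of \<open>\<bar>x - xc\<bar>\<^sup>2\<close> makes the contact strict and, by continuity, leaves
  the Laplacian of \<open>Q\<close> nonnegative near the contact point.\<close>

lemma distr_superharmonic_no_touching:
  fixes u Q :: "real^'n \<Rightarrow> real" and Q1 Q2 :: "'n \<Rightarrow> real^'n \<Rightarrow> real"
  assumes S: "open S" "xc \<in> S"
    and u: "continuous_on S u" "distr_laplacian_nonpos_on S u"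
    and Q1: "\<And>i x. x \<in> S \<Longrightarrow> ((\<lambda>t. Q (x + t *\<^sub>R axis i 1)) has_real_derivative Q1 i x) (at 0)"
    and Q2: "\<And>i x. x \<in> S \<Longrightarrow> ((\<lambda>t. Q1 i (x + t *\<^sub>R axis i 1)) has_real_derivative Q2 i x) (at 0)"
    and cQ: "continuous_on S Q" "\<And>i. continuous_on S (Q1 i)" "\<And>i. continuous_on S (Q2 i)"
    and sub: "(\<Sum>i\<in>UNIV. Q2 i xc) > 0"
    and touch: "\<forall>\<^sub>F x in nhds xc. u x - Q x \<ge> u xc - Q xc"
  shows False
proof -
  define \<kappa> where "\<kappa> = (\<Sum>i\<in>UNIV. Q2 i xc)"
  define \<epsilon> where "\<epsilon> = \<kappa> / (4 * real CARD('n))"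
  have k: "\<kappa> > 0" "\<epsilon> > 0" using sub by (auto simp: \<kappa>_def \<epsilon>_def)
  have "isCont (\<lambda>x. \<Sum>i\<in>UNIV. Q2 i x) xc"
    using S cQ(3) by (intro continuous_intros) (simp add: continuous_on_eq_continuous_at)
  hence "\<forall>\<^sub>F x in at xc. (\<Sum>i\<in>UNIV. Q2 i x) > \<kappa>/2"
    using k by (intro order_tendstoD(1)[of _ \<kappa>]) (auto simp: \<kappa>_def isCont_def)
  hence "\<forall>\<^sub>F x in nhds xc. (\<Sum>i\<in>UNIV. Q2 i x) > \<kappa>/2"
    using k by (simp add: eventually_nhds_conv_at \<kappa>_def)
  moreover have "\<forall>\<^sub>F x in nhds xc. x \<in> S" using S eventually_nhds_in_open by blast
  ultimately have "\<forall>\<^sub>F x in nhds xc. x \<in> S \<and> (\<Sum>i\<in>UNIV. Q2 i x) > \<kappa>/2 \<and> u x - Q x \<ge> u xc - Q xc"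
    using touch by eventually_elim simp
  then obtain d where d: "d > 0"
    "\<And>x. dist x xc < d \<Longrightarrow> x \<in> S \<and> (\<Sum>i\<in>UNIV. Q2 i x) > \<kappa>/2 \<and> u x - Q x \<ge> u xc - Q xc"
    unfolding eventually_nhds_metric by blast
  have dd: "x \<in> S \<and> (\<Sum>i\<in>UNIV. Q2 i x) > \<kappa>/2 \<and> u x - Q x \<ge> u xc - Q xc" if "x \<in> cball xc (d/2)" for x
    using that d(1) by (intro d(2)) (simp add: dist_commute)
  define P where "P x = Q x - \<epsilon> * (norm (x - xc))\<^sup>2" for x
  define P1 where "P1 i x = Q1 i x - \<epsilon> * (2 * ((x - xc) $ i))" for i x
  define P2 where "P2 i x = Q2 i x - \<epsilon> * 2" for i :: 'n and x
  have n1: "((\<lambda>t. (norm (x + t *\<^sub>R axis i 1 - xc))\<^sup>2) has_real_derivative 2 * ((x - xc) $ i)) (at 0)" for i x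
    using has_derivative_imp_directional[OF has_derivative_radial[of "\<lambda>r. r" "\<lambda>_. 1" xc x], of "axis i 1"]
    by (simp add: inner_axis)
  have n2: "((\<lambda>t. 2 * ((x + t *\<^sub>R axis i 1 - xc) $ i)) has_real_derivative 2) (at 0)" for i x
    by (auto intro!: derivative_eq_intros simp: algebra_simps)
  show False
  proof (rule distr_superharmonic_no_strict_touching[OF S(1) _ _ u, of xc "d/2" P P1 P2])
    show "cball xc (d/2) \<subseteq> S" using dd by blast
    show "d/2 > 0" using d by simp
    show "((\<lambda>t. P (x + t *\<^sub>R axis i 1)) has_real_derivative P1 i x) (at 0)" if "x \<in> S" for i x
      unfolding P_def P1_def by (intro DERIV_diff Q1[OF that] DERIV_cmult n1)
    show "((\<lambda>t. P1 i (x + t *\<^sub>R axis i 1)) has_real_derivative P2 i x) (at 0)" if "x \<in> S" for i x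
      unfolding P1_def P2_def by (intro DERIV_diff Q2[OF that] DERIV_cmult n2)
    show "continuous_on S P" "continuous_on S (P1 i)" "continuous_on S (P2 i)" for i
      unfolding P_def P1_def P2_def by (intro continuous_intros cQ)+
    show "(\<Sum>i\<in>UNIV. P2 i x) \<ge> 0" if "x \<in> cball xc (d/2)" for x
      using dd[OF that] by (simp add: P2_def sum_subtractf \<epsilon>_def)
    show "u x - P x > u xc - P xc" if "x \<in> cball xc (d/2)" "x \<noteq> xc" for x
    proof -
      have "\<epsilon> * (norm (x - xc))\<^sup>2 > 0" using k that by simp
      thus ?thesis using dd[OF that(1)] by (simp add: P_def)
    qed
  qed
qed

section \<open>Comparison on a punctured ball\<close>

text \<open>The barrier is a quadratic polynomial plus \<open>\<delta> ln \<bar>x\<bar>\<^sup>2\<close>. In dimension at least two the logarithm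
  is subharmonic away from the origin, where it tends to \<open>-\<infinity>\<close>; so it can play the part of the
  fundamental solution without a distinction between dimension two and higher dimensions.\<close>

lemma log_barrier_derivatives:
  fixes x p e :: "real^'n" and \<alpha> b \<theta> \<delta> :: real
  defines "Q \<equiv> \<lambda>x. \<alpha> + p \<bullet> x + b * (e \<bullet> x)\<^sup>2 + \<theta> * (norm x)\<^sup>2 + \<delta> * ln ((norm x)\<^sup>2)"
    and "Q1 \<equiv> \<lambda>i x. p $ i + 2 * b * (e \<bullet> x) * (e $ i) + 2 * \<theta> * (x $ i)
                + \<delta> * (2 * (x $ i) / (norm x)\<^sup>2)"
    and "Q2 \<equiv> \<lambda>i x. 2 * b * (e $ i)\<^sup>2 + 2 * \<theta>
                + \<delta> * (2 / (norm x)\<^sup>2 - 4 * (x $ i)\<^sup>2 / ((norm x)\<^sup>2)\<^sup>2)"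
  assumes "x \<noteq> 0"
  shows "((\<lambda>t. Q (x + t *\<^sub>R axis i 1)) has_real_derivative Q1 i x) (at 0)"
    and "((\<lambda>t. Q1 i (x + t *\<^sub>R axis i 1)) has_real_derivative Q2 i x) (at 0)"
    and "(\<Sum>i\<in>UNIV. Q2 i x) = 2 * b * (norm e)\<^sup>2 + 2 * real CARD('n) * \<theta>
           + \<delta> * (2 * real CARD('n) - 4) / (norm x)\<^sup>2"
proof -
  have N1: "((\<lambda>t. (norm (x + t *\<^sub>R axis i 1))\<^sup>2) has_real_derivative 2 * (x $ i)) (at 0)"
    using has_derivative_imp_directional[OF has_derivative_radial[of "\<lambda>r. r" "\<lambda>_. 1" 0 x], of "axis i 1"]
    by (simp add: inner_axis)
  have nz: "(norm x)\<^sup>2 > 0" using assms(4) by simp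
  have L1: "((\<lambda>t. ln ((norm (x + t *\<^sub>R axis i 1))\<^sup>2)) has_real_derivative 2 * (x $ i) / (norm x)\<^sup>2) (at 0)"
    by (rule DERIV_cong[OF DERIV_chain2[OF _ N1], of ln "1 / (norm (x + 0 *\<^sub>R axis i 1))\<^sup>2"])
       (use nz in \<open>auto intro!: DERIV_ln_divide\<close>)
  have I1: "((\<lambda>t. e \<bullet> (x + t *\<^sub>R axis i 1)) has_real_derivative e $ i) (at 0)" for e :: "real^'n"
    by (auto intro!: derivative_eq_intros simp: inner_add_right inner_axis)
  have C1: "((\<lambda>t. (x + t *\<^sub>R axis i 1) $ i) has_real_derivative 1) (at 0)"
    by (auto intro!: derivative_eq_intros)
  show "((\<lambda>t. Q (x + t *\<^sub>R axis i 1)) has_real_derivative Q1 i x) (at 0)"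
  proof -
    have "((\<lambda>t. Q (x + t *\<^sub>R axis i 1)) has_real_derivative
        0 + p $ i + b * (of_nat 2 * (e $ i * (e \<bullet> (x + 0 *\<^sub>R axis i 1)) ^ (2 - Suc 0)))
          + \<theta> * (2 * (x $ i)) + \<delta> * (2 * (x $ i) / (norm x)\<^sup>2)) (at 0)"
      unfolding Q_def
      by (intro DERIV_add DERIV_const DERIV_cmult DERIV_power I1 N1 L1)
    thus ?thesis by (simp add: Q1_def algebra_simps)
  qed
  show "((\<lambda>t. Q1 i (x + t *\<^sub>R axis i 1)) has_real_derivative Q2 i x) (at 0)"
  proof -
    have D: "((\<lambda>t. 2 * ((x + t *\<^sub>R axis i 1) $ i) / (norm (x + t *\<^sub>R axis i 1))\<^sup>2) has_real_derivative
       ((2 * 1) * (norm (x + 0 *\<^sub>R axis i 1))\<^sup>2 - 2 * ((x + 0 *\<^sub>R axis i 1) $ i) * (2 * (x $ i)))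
         / ((norm (x + 0 *\<^sub>R axis i 1))\<^sup>2 * (norm (x + 0 *\<^sub>R axis i 1))\<^sup>2)) (at 0)"
      by (intro DERIV_divide DERIV_cmult C1 N1) (use nz in simp)
    have "((\<lambda>t. Q1 i (x + t *\<^sub>R axis i 1)) has_real_derivative
        0 + 2 * b * (e $ i) * (e $ i) + 2 * \<theta> * 1 + \<delta> * (((2 * 1) * (norm (x + 0 *\<^sub>R axis i 1))\<^sup>2
           - 2 * ((x + 0 *\<^sub>R axis i 1) $ i) * (2 * (x $ i)))
         / ((norm (x + 0 *\<^sub>R axis i 1))\<^sup>2 * (norm (x + 0 *\<^sub>R axis i 1))\<^sup>2))) (at 0)"
      unfolding Q1_def
      by (intro DERIV_add DERIV_const DERIV_cmult DERIV_cmult_right I1 C1 D)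
    moreover have alg: "((2 * 1) * N - 2 * y * (2 * y)) / (N * N) = 2 / N - 4 * y\<^sup>2 / N\<^sup>2"
      if "N > 0" for N y :: real
      using that by (simp add: field_simps power2_eq_square)
    moreover have "x + 0 *\<^sub>R axis i 1 = x" by simp
    ultimately have "((\<lambda>t. Q1 i (x + t *\<^sub>R axis i 1)) has_real_derivative
        0 + 2 * b * (e $ i) * (e $ i) + 2 * \<theta> * 1
          + \<delta> * (2 / (norm x)\<^sup>2 - 4 * (x $ i)\<^sup>2 / ((norm x)\<^sup>2)\<^sup>2)) (at 0)"
      using nz by (simp only: alg)
    thus ?thesis by (simp add: Q2_def power2_eq_square[of "e $ i"] mult.assoc)
  qed
  have nn: "(norm y)\<^sup>2 = (\<Sum>i\<in>UNIV. (y $ i)\<^sup>2)" for y :: "real^'n"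
    by (simp only: power2_norm_eq_inner inner_vec_def inner_real_def) (simp only: power2_eq_square)
  have "(\<Sum>i\<in>UNIV. Q2 i x) = 2 * b * (\<Sum>i\<in>UNIV. (e $ i)\<^sup>2) + 2 * real CARD('n) * \<theta>
      + \<delta> * (2 * real CARD('n) / (norm x)\<^sup>2 - 4 * (\<Sum>i\<in>UNIV. (x $ i)\<^sup>2) / ((norm x)\<^sup>2)\<^sup>2)"
    by (simp add: Q2_def sum.distrib sum_subtractf flip: sum_distrib_left sum_divide_distrib)
  also have "\<dots> = 2 * b * (norm e)\<^sup>2 + 2 * real CARD('n) * \<theta>
      + \<delta> * (2 * real CARD('n) / (norm x)\<^sup>2 - 4 / (norm x)\<^sup>2)"
    unfolding nn[symmetric] using nz by (simp add: power2_eq_square)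
  finally show "(\<Sum>i\<in>UNIV. Q2 i x) = 2 * b * (norm e)\<^sup>2 + 2 * real CARD('n) * \<theta>
           + \<delta> * (2 * real CARD('n) - 4) / (norm x)\<^sup>2"
    by (simp add: diff_divide_distrib right_diff_distrib)
qed

text \<open>The isolated singularity is invisible to the minimum principle. Adding \<open>\<delta> (ln \<bar>x\<bar>\<^sup>2 - ln r\<^sup>2) \<le> 0\<close>
  to \<open>q\<close> preserves strict subharmonicity and the boundary inequality, and pushes the comparison
  function below the lower bound \<open>L\<close> of \<open>u\<close> near the origin. A negative minimum of the difference
  would then be attained at an interior point other than the origin, which the touching lemma
  excludes. Finally \<open>\<delta>\<close> tends to zero.\<close>

lemma distr_superharmonic_ge_quadratic_on_punctured_ball:
  fixes u :: "real^'n \<Rightarrow> real" and p e :: "real^'n"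
  assumes n2: "CARD('n) \<ge> 2" and r: "r > 0"
    and S: "open S" "0 \<notin> S" "cball 0 r - {0} \<subseteq> S"
    and u: "continuous_on S u" "distr_laplacian_nonpos_on S u"
    and below: "\<And>x. x \<noteq> 0 \<Longrightarrow> norm x \<le> r \<Longrightarrow> u x \<ge> L"
    and lap: "2 * b * (norm e)\<^sup>2 + 2 * real CARD('n) * \<theta> > 0"
    and q: "q = (\<lambda>x. \<alpha> + p \<bullet> x + b * (e \<bullet> x)\<^sup>2 + \<theta> * (norm x)\<^sup>2)"
    and bd: "\<And>x. norm x = r \<Longrightarrow> u x \<ge> q x"
    and x: "x \<noteq> 0" "norm x \<le> r"
  shows "u x \<ge> q x"
proof -
  have cq: "continuous_on A q" for A unfolding q by (intro continuous_intros)
  have "compact (q ` cball 0 r)" by (intro compact_continuous_image cq) auto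
  then obtain M0 where M0: "\<And>x. norm x \<le> r \<Longrightarrow> \<bar>q x\<bar> \<le> M0"
    using compact_imp_bounded bounded_real by (metis (no_types, lifting) image_eqI mem_cball_0)
  define M where "M = max M0 L"
  have M: "q x \<le> M" if "norm x \<le> r" for x using M0[OF that] by (simp add: M_def)
  have key: "u x \<ge> q x + \<delta> * (ln ((norm x)\<^sup>2) - ln (r\<^sup>2))" if \<delta>: "\<delta> > 0" for \<delta>
  proof (rule ccontr)
    define g where "g x = u x - (q x + \<delta> * (ln ((norm x)\<^sup>2) - ln (r\<^sup>2)))" for x
    assume "\<not> ?thesis"
    hence gx: "g x < 0" by (simp add: g_def)
    \<comment> \<open>the radius at which the logarithmic term has dropped to \<open>L - M\<close>\<close>
    define \<rho> where "\<rho> = r * exp (- (M - L) / (2 * \<delta>))"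
    have \<rho>: "\<rho> > 0" using r by (simp add: \<rho>_def)
    have near: "g y \<ge> 0" if "y \<noteq> 0" "norm y \<le> \<rho>" "norm y \<le> r" for y
    proof -
      have "ln ((norm y)\<^sup>2) \<le> ln (\<rho>\<^sup>2)" using that \<rho> by (simp add: power_mono)
      also have "\<dots> = ln (r\<^sup>2) - (M - L) / \<delta>"
        using r \<delta> by (simp add: \<rho>_def ln_realpow ln_mult field_simps)
      finally have "\<delta> * (ln ((norm y)\<^sup>2) - ln (r\<^sup>2)) \<le> \<delta> * (- ((M - L) / \<delta>))"
        using \<delta> by (intro mult_left_mono) auto
      hence "\<delta> * (ln ((norm y)\<^sup>2) - ln (r\<^sup>2)) \<le> L - M" using \<delta> by simp
      thus ?thesis using below[OF that(1,3)] M[OF that(3)] by (simp add: g_def)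
    qed
    define K where "K = cball 0 r - ball (0::real^'n) \<rho>"
    have K: "compact K" unfolding K_def by (intro compact_diff) auto
    have KS: "K \<subseteq> S" using S \<rho> by (auto simp: K_def)
    have "norm x > \<rho>" using near[OF x(1) _ x(2)] gx by linarith
    hence xK: "x \<in> K" using x by (simp add: K_def)
    have cg: "continuous_on K g" unfolding g_def
      by (intro continuous_intros cq continuous_on_subset[OF u(1) KS]) (use KS S in auto)
    obtain z where z: "z \<in> K" "\<And>y. y \<in> K \<Longrightarrow> g z \<le> g y"
      using continuous_attains_inf[OF K _ cg] xK by blast
    have gz: "g z < 0" using z(2)[OF xK] gx by simp
    have z0: "z \<noteq> 0" using z(1) \<rho> by (auto simp: K_def)
    have "norm z \<noteq> r" using gz bd[of z] by (auto simp: g_def)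
    hence zr: "norm z < r" using z(1) by (auto simp: K_def)
    have z\<rho>: "norm z > \<rho>" using near[OF z0] gz zr by force
    have "open (ball 0 r - cball (0::real^'n) \<rho>)" "z \<in> ball 0 r - cball 0 \<rho>" using zr z\<rho> by auto
    hence "\<forall>\<^sub>F y in nhds z. y \<in> ball 0 r - cball 0 \<rho>" by (rule eventually_nhds_in_open)
    hence loc: "\<forall>\<^sub>F y in nhds z. g y \<ge> g z" by eventually_elim (auto intro!: z(2) simp: K_def)
    define Q where "Q \<equiv> \<lambda>x. (\<alpha> - \<delta> * ln (r\<^sup>2)) + p \<bullet> x + b * (e \<bullet> x)\<^sup>2 + \<theta> * (norm x)\<^sup>2 + \<delta> * ln ((norm x)\<^sup>2)"
    define Q1 where "Q1 \<equiv> \<lambda>i x. p $ i + 2 * b * (e \<bullet> x) * (e $ i) + 2 * \<theta> * (x $ i)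
                + \<delta> * (2 * (x $ i) / (norm x)\<^sup>2)"
    define Q2 where "Q2 \<equiv> \<lambda>i x. 2 * b * (e $ i)\<^sup>2 + 2 * \<theta>
                + \<delta> * (2 / (norm x)\<^sup>2 - 4 * (x $ i)\<^sup>2 / ((norm x)\<^sup>2)\<^sup>2)"
    have S0: "y \<noteq> 0" if "y \<in> S" for y using that S by auto
    show False
    proof (rule distr_superharmonic_no_touching[OF S(1) _ u, of z Q Q1 Q2])
      show "z \<in> S" using z(1) KS by auto
      show "((\<lambda>t. Q (y + t *\<^sub>R axis i 1)) has_real_derivative Q1 i y) (at 0)"
           "((\<lambda>t. Q1 i (y + t *\<^sub>R axis i 1)) has_real_derivative Q2 i y) (at 0)" if "y \<in> S" for i y
        unfolding Q_def Q1_def Q2_def using S0[OF that] by (rule log_barrier_derivatives)+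
      show "continuous_on S Q" "continuous_on S (Q1 i)" "continuous_on S (Q2 i)" for i
        unfolding Q_def Q1_def Q2_def using S0 by (auto intro!: continuous_intros)
      have "(\<Sum>i\<in>UNIV. Q2 i z) = 2 * b * (norm e)\<^sup>2 + 2 * real CARD('n) * \<theta>
           + \<delta> * (2 * real CARD('n) - 4) / (norm z)\<^sup>2"
        unfolding Q2_def using z0 by (rule log_barrier_derivatives(3))
      moreover have "\<delta> * (2 * real CARD('n) - 4) / (norm z)\<^sup>2 \<ge> 0"
        using \<delta> n2 by (intro divide_nonneg_nonneg mult_nonneg_nonneg) auto
      ultimately show "(\<Sum>i\<in>UNIV. Q2 i z) > 0" using lap by linarith
      have "u y - Q y = g y" for y by (simp add: g_def Q_def q algebra_simps)
      thus "\<forall>\<^sub>F y in nhds z. u y - Q y \<ge> u z - Q z" using loc by simp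
    qed
  qed
  show ?thesis
  proof (rule ccontr)
    assume "\<not> u x \<ge> q x"
    define c where "c = ln (r\<^sup>2) - ln ((norm x)\<^sup>2)"
    have c: "c \<ge> 0" using x r by (simp add: c_def power_mono)
    define \<delta> where "\<delta> = (q x - u x) / (2 * (c + 1))"
    have \<delta>: "\<delta> > 0" using \<open>\<not> u x \<ge> q x\<close> c by (simp add: \<delta>_def)
    have "u x \<ge> q x - \<delta> * c" using key[OF \<delta>] by (simp add: c_def algebra_simps)
    moreover have "\<delta> * c < q x - u x"
    proof -
      have "\<delta> * c < \<delta> * (2 * (c + 1))" using \<delta> c by (intro mult_strict_left_mono) auto
      also have "\<dots> = q x - u x" using c by (simp add: \<delta>_def)
      finally show ?thesis .
    qed
    ultimately show False by linarith
  qed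
qed

section \<open>Minorants touching at an isolated singularity\<close>

text \<open>This replaces the mean value inequality for the superharmonic extension of \<open>u\<close> across the origin:
  the inequality on the sphere spreads to the punctured ball, and the continuous quadratic function
  inherits the bound at the centre. The hypothesis \<open>low\<close> says that the lower limit of \<open>u\<close> at the
  origin is at most \<open>c\<close>.\<close>

lemma distr_superharmonic_quadratic_minorant_center:
  fixes u :: "real^'n \<Rightarrow> real" and p e :: "real^'n"
  assumes n2: "CARD('n) \<ge> 2" and r: "r > 0"
    and S: "open S" "0 \<notin> S" "cball 0 r - {0} \<subseteq> S"
    and u: "continuous_on S u" "distr_laplacian_nonpos_on S u"
    and below: "\<And>x. x \<noteq> 0 \<Longrightarrow> norm x \<le> r \<Longrightarrow> u x \<ge> L"
    and low: "\<And>\<epsilon> d. \<epsilon> > 0 \<Longrightarrow> d > 0 \<Longrightarrow> \<exists>x. x \<noteq> 0 \<and> norm x < d \<and> u x < c + \<epsilon>"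
    and lap: "2 * b * (norm e)\<^sup>2 + 2 * real CARD('n) * \<theta> > 0"
    and bd: "\<And>x. norm x = r \<Longrightarrow> u x \<ge> \<alpha> + p \<bullet> x + b * (e \<bullet> x)\<^sup>2 + \<theta> * (norm x)\<^sup>2"
  shows "\<alpha> \<le> c"
proof (rule ccontr)
  assume "\<not> \<alpha> \<le> c"
  define \<epsilon> where "\<epsilon> = (\<alpha> - c) / 2"
  have \<epsilon>: "\<epsilon> > 0" using \<open>\<not> \<alpha> \<le> c\<close> by (simp add: \<epsilon>_def)
  define q where "q = (\<lambda>x. \<alpha> + p \<bullet> x + b * (e \<bullet> x)\<^sup>2 + \<theta> * (norm x)\<^sup>2)"
  have "isCont q 0" unfolding q_def by (intro continuous_intros)
  moreover have "q 0 = \<alpha>" by (simp add: q_def)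
  ultimately obtain d where d: "d > 0" "\<And>x. dist x 0 < d \<Longrightarrow> dist (q x) \<alpha> < \<epsilon>"
    unfolding continuous_at_eps_delta using \<epsilon> by metis
  obtain x where x: "x \<noteq> 0" "norm x < min d r" "u x < c + \<epsilon>"
    using low[OF \<epsilon>, of "min d r"] d(1) r by auto
  have "u x \<ge> q x"
    by (rule distr_superharmonic_ge_quadratic_on_punctured_ball[OF n2 r S u below lap q_def])
       (use bd x in \<open>auto simp: q_def\<close>)
  moreover have "q x > \<alpha> - \<epsilon>" using d(2)[of x] x(2) by (simp add: dist_real_def abs_less_iff)
  ultimately show False using x(3) unfolding \<epsilon>_def by (simp add: field_simps)
qed

text \<open>If two differentiable minorants touch at the singular point with different gradients
  \<open>p \<plusminus> a\<close>, then \<open>u\<close> lies above the wedge \<open>c + p \<bullet> x + \<bar>a \<bullet> x\<bar>\<close> up to \<open>o(\<bar>x\<bar>)\<close>. On the sphere of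
  radius \<open>r\<close> the wedge dominates \<open>(a \<bullet> x)\<^sup>2 / (\<bar>a\<bar> r)\<close>, and subtracting the
  multiple \<open>\<bar>a\<bar> (\<bar>x\<bar>\<^sup>2 - r\<^sup>2) / (2 n r)\<close>, which is zero on the sphere, keeps this quadratic strictly
  subharmonic but lifts its centre by \<open>\<bar>a\<bar> r / (2 n)\<close>: more than the error term can
  compensate, so the centre would lie above \<open>c\<close>.\<close>

lemma distr_superharmonic_gradient_unique:
  fixes u w1 w2 :: "real^'n \<Rightarrow> real" and p1 p2 :: "real^'n"
  assumes n2: "CARD('n) \<ge> 2" and r0: "r0 > 0"
    and S: "open S" "0 \<notin> S" "cball 0 r0 - {0} \<subseteq> S"
    and u: "continuous_on S u" "distr_laplacian_nonpos_on S u"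
    and w: "(w1 has_derivative (\<lambda>h. p1 \<bullet> h)) (at 0)" "(w2 has_derivative (\<lambda>h. p2 \<bullet> h)) (at 0)"
      "w1 0 = c" "w2 0 = c"
    and ge: "\<And>x. x \<noteq> 0 \<Longrightarrow> norm x \<le> r0 \<Longrightarrow> u x \<ge> w1 x" "\<And>x. x \<noteq> 0 \<Longrightarrow> norm x \<le> r0 \<Longrightarrow> u x \<ge> w2 x"
    and low: "\<And>\<epsilon> d. \<epsilon> > 0 \<Longrightarrow> d > 0 \<Longrightarrow> \<exists>x. x \<noteq> 0 \<and> norm x < d \<and> u x < c + \<epsilon>"
  shows "p1 = p2"
proof (rule ccontr)
  assume ne: "p1 \<noteq> p2"
  define a where "a = (1/2) *\<^sub>R (p1 - p2)"
  define p where "p = (1/2) *\<^sub>R (p1 + p2)"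
  have pa: "p \<bullet> x + a \<bullet> x = p1 \<bullet> x" "p \<bullet> x - a \<bullet> x = p2 \<bullet> x" for x
    by (simp_all add: p_def a_def inner_add_left inner_diff_left field_simps)
  define A where "A = norm a"
  have A: "A > 0" using ne by (simp add: A_def a_def)
  define n where "n = real CARD('n)"
  have n: "n > 0" by (simp add: n_def)
  define \<kappa> where "\<kappa> = A / (4 * n)"
  have \<kappa>: "\<kappa> > 0" using A n by (simp add: \<kappa>_def)
  obtain d1 where d1: "d1 > 0" "\<And>x. norm x < d1 \<Longrightarrow> \<bar>w1 x - c - p1 \<bullet> x\<bar> \<le> \<kappa> * norm x"
    using w(1,3) \<kappa> unfolding has_derivative_at_alt by (metis diff_zero real_norm_def)
  obtain d2 where d2: "d2 > 0" "\<And>x. norm x < d2 \<Longrightarrow> \<bar>w2 x - c - p2 \<bullet> x\<bar> \<le> \<kappa> * norm x"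
    using w(2,4) \<kappa> unfolding has_derivative_at_alt by (metis diff_zero real_norm_def)
  define r where "r = min r0 (min d1 d2) / 2"
  have r: "r > 0" "r < d1" "r < d2" "r \<le> r0" using r0 d1(1) d2(1) by (auto simp: r_def)
  have "c + A * r / (2 * n) - \<kappa> * r \<le> c"
  proof (rule distr_superharmonic_quadratic_minorant_center[OF n2 r(1) S(1,2) _ u _ low,
      where b = "1 / (A * r)" and e = a and \<theta> = "- A / (2 * n * r)" and p = p
        and L = "c - norm p1 * r - \<kappa> * r"])
    show "cball 0 r - {0} \<subseteq> S" using S(3) subset_cball[OF r(4), of 0] by blast
    show "c - norm p1 * r - \<kappa> * r \<le> u x" if "x \<noteq> 0" "norm x \<le> r" for x
    proof -
      have "\<bar>p1 \<bullet> x\<bar> \<le> norm p1 * r"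
        using Cauchy_Schwarz_ineq2[of p1 x] mult_left_mono[OF that(2) norm_ge_zero[of p1]] by linarith
      moreover have "\<kappa> * norm x \<le> \<kappa> * r" using that \<kappa> by simp
      ultimately show ?thesis using d1(2)[of x] ge(1)[of x] that r by auto
    qed
    have "2 * (1 / (A * r)) * (norm a)\<^sup>2 + 2 * n * (- A / (2 * n * r)) = A / r"
      unfolding A_def[symmetric] using A n r by (simp add: field_simps power2_eq_square)
    thus "0 < 2 * (1 / (A * r)) * (norm a)\<^sup>2 + 2 * real CARD('n) * (- A / (2 * n * r))"
      using A r by (simp add: n_def)
    show "c + A * r / (2 * n) - \<kappa> * r + p \<bullet> x + 1 / (A * r) * (a \<bullet> x)\<^sup>2
        + - A / (2 * n * r) * (norm x)\<^sup>2 \<le> u x" if x: "norm x = r" for x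
    proof -
      have x0: "x \<noteq> 0" using x r by auto
      have "\<bar>a \<bullet> x\<bar> \<le> A * r" using Cauchy_Schwarz_ineq2[of a x] x by (simp add: A_def)
      hence "\<bar>a \<bullet> x\<bar> * \<bar>a \<bullet> x\<bar> \<le> (A * r) * \<bar>a \<bullet> x\<bar>" by (rule mult_right_mono) simp
      hence "1 / (A * r) * (a \<bullet> x)\<^sup>2 \<le> \<bar>a \<bullet> x\<bar>"
        using A r by (simp add: field_simps power2_eq_square)
      moreover have "- A / (2 * n * r) * (norm x)\<^sup>2 = - (A * r / (2 * n))"
        using r n x by (simp add: field_simps power2_eq_square)
      moreover have "c - \<kappa> * r + p \<bullet> x + \<bar>a \<bullet> x\<bar> \<le> u x"
      proof (cases "a \<bullet> x \<ge> 0")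
        case True
        thus ?thesis using d1(2)[of x] ge(1)[OF x0] pa(1)[of x] x r by auto
      next
        case False
        thus ?thesis using d2(2)[of x] ge(2)[OF x0] pa(2)[of x] x r by auto
      qed
      ultimately show ?thesis by linarith
    qed
  qed
  moreover have "A * r / (2 * n) - \<kappa> * r = A * r / (4 * n)" using n by (simp add: \<kappa>_def field_simps)
  moreover have "A * r / (4 * n) > 0" using A r n by simp
  ultimately show False by linarith
qed

text \<open>By compactness \<open>u\<close> exceeds the affine function by a fixed amount \<open>2 \<delta>\<close> on a sphere, so there is
  room for the strictly subharmonic paraboloid \<open>c + \<delta> + p \<bullet> x + \<delta> \<bar>x\<bar>\<^sup>2 / r\<^sup>2\<close> below \<open>u\<close>.\<close>

lemma distr_superharmonic_no_strict_affine_minorant: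
  fixes u :: "real^'n \<Rightarrow> real" and p :: "real^'n"
  assumes n2: "CARD('n) \<ge> 2" and r: "r > 0"
    and S: "open S" "0 \<notin> S" "cball 0 r - {0} \<subseteq> S"
    and u: "continuous_on S u" "distr_laplacian_nonpos_on S u"
    and gt: "\<And>x. x \<noteq> 0 \<Longrightarrow> norm x \<le> r \<Longrightarrow> u x > c + p \<bullet> x"
    and low: "\<And>\<epsilon> d. \<epsilon> > 0 \<Longrightarrow> d > 0 \<Longrightarrow> \<exists>x. x \<noteq> 0 \<and> norm x < d \<and> u x < c + \<epsilon>"
  shows False
proof -
  have sS: "sphere 0 r \<subseteq> S" using S(3) r by auto
  have "continuous_on (sphere 0 r) (\<lambda>x. u x - (c + p \<bullet> x))"
    by (intro continuous_intros continuous_on_subset[OF u(1) sS])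
  moreover have "sphere (0::real^'n) r \<noteq> {}" using r by simp
  ultimately obtain z where z: "norm z = r" "\<And>x. norm x = r \<Longrightarrow> u z - (c + p \<bullet> z) \<le> u x - (c + p \<bullet> x)"
    using continuous_attains_inf[of "sphere 0 r" "\<lambda>x. u x - (c + p \<bullet> x)"] by auto
  define \<delta> where "\<delta> = (u z - (c + p \<bullet> z)) / 2"
  have \<delta>: "\<delta> > 0" using gt[of z] z(1) r by (auto simp: \<delta>_def)
  have "c + \<delta> \<le> c"
  proof (rule distr_superharmonic_quadratic_minorant_center[OF n2 r S u _ low,
      where b = 0 and e = 0 and \<theta> = "\<delta> / r\<^sup>2" and p = p and L = "c - norm p * r"])
    show "c - norm p * r \<le> u x" if "x \<noteq> 0" "norm x \<le> r" for x
    proof -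
      have "\<bar>p \<bullet> x\<bar> \<le> norm p * r"
        using Cauchy_Schwarz_ineq2[of p x] mult_left_mono[OF that(2) norm_ge_zero[of p]] by linarith
      thus ?thesis using gt[OF that] by linarith
    qed
    show "0 < 2 * 0 * (norm (0::real^'n))\<^sup>2 + 2 * real CARD('n) * (\<delta> / r\<^sup>2)"
      using \<delta> r by simp
    show "c + \<delta> + p \<bullet> x + 0 * (0 \<bullet> x)\<^sup>2 + \<delta> / r\<^sup>2 * (norm x)\<^sup>2 \<le> u x" if "norm x = r" for x
      using z(2)[OF that] that r by (simp add: \<delta>_def)
  qed
  thus False using \<delta> by simp
qed

section \<open>Regularity of the dilation family and of the primitive\<close>

definition gradient :: "(real^'n::finite \<Rightarrow> real) \<Rightarrow> real^'n \<Rightarrow> real^'n" where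
  "gradient f x = (\<chi> i. partial i f x)"

lemma has_derivative_gradient:
  assumes "f differentiable (at x)"
  shows "(f has_derivative (\<lambda>h. gradient f x \<bullet> h)) (at x)"
proof -
  define F where "F = frechet_derivative f (at x)"
  have F: "(f has_derivative F) (at x)" using assms by (simp add: F_def frechet_derivative_works)
  interpret linear F using F by (rule has_derivative_linear)
  have "F h = gradient f x \<bullet> h" for h
  proof -
    have "F h = F (\<Sum>i\<in>UNIV. (h $ i) *\<^sub>R axis i 1)" by (simp add: basis_expansion flip: scalar_mult_eq_scaleR)
    also have "\<dots> = gradient f x \<bullet> h"
      by (simp add: sum scale gradient_def partial_def F_def[symmetric] inner_vec_def mult.commute)
    finally show ?thesis .
  qed
  hence "F = (\<lambda>h. gradient f x \<bullet> h)" by (rule ext)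
  thus ?thesis using F by simp
qed

lemma Ck_on_1_locally_lipschitz:
  fixes v :: "real^'n \<Rightarrow> real"
  assumes "open W" "a \<in> W" "Ck_on 1 W v"
  obtains \<rho> C where "\<rho> > 0" "C \<ge> 0" "cball a \<rho> \<subseteq> W"
    "\<And>x y. x \<in> cball a \<rho> \<Longrightarrow> y \<in> cball a \<rho> \<Longrightarrow> \<bar>v x - v y\<bar> \<le> C * norm (x - y)"
proof -
  obtain \<rho> where \<rho>: "\<rho> > 0" "cball a \<rho> \<subseteq> W" using assms open_contains_cball by blast
  have d: "(v has_derivative (\<lambda>h. gradient v x \<bullet> h)) (at x)" if "x \<in> W" for x
    using assms that by (intro has_derivative_gradient) simp
  have "continuous_on W (partial i v)" for i using assms(3) by simp
  hence "continuous_on W (gradient v)"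
    unfolding gradient_def by (intro continuous_on_vec_lambda) 
  hence "compact (gradient v ` cball a \<rho>)"
    by (intro compact_continuous_image continuous_on_subset[OF _ \<rho>(2)]) auto
  then obtain C where C: "\<And>x. x \<in> cball a \<rho> \<Longrightarrow> norm (gradient v x) \<le> C"
    using compact_imp_bounded bounded_iff by (metis (no_types, lifting) image_eqI)
  have C0: "C \<ge> 0" using C[of a] \<rho>(1) norm_ge_zero[of "gradient v a"] by (simp del: norm_ge_zero)
  have "\<bar>v x - v y\<bar> \<le> C * norm (x - y)" if "x \<in> cball a \<rho>" "y \<in> cball a \<rho>" for x y
  proof -
    have "norm (v x - v y) \<le> C * norm (x - y)"
    proof (rule differentiable_bound[where S = "cball a \<rho>" and f' = "\<lambda>x h. gradient v x \<bullet> h"])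
      fix z assume z: "z \<in> cball a \<rho>"
      show "(v has_derivative (\<lambda>h. gradient v z \<bullet> h)) (at z within cball a \<rho>)"
        using d z \<rho>(2) by (blast intro: has_derivative_at_withinI)
      show "onorm (\<lambda>h. gradient v z \<bullet> h) \<le> C"
      proof (rule onorm_bound[OF C0])
        show "norm (gradient v z \<bullet> h) \<le> C * norm h" for h
          using Cauchy_Schwarz_ineq2[of "gradient v z" h] mult_right_mono[OF C[OF z] norm_ge_zero[of h]]
          by simp
      qed
    qed (use that in auto)
    thus ?thesis by simp
  qed
  thus ?thesis using that \<rho> C0 by blast
qed

text \<open>A compact set keeps a positive distance from the complement of \<open>U\<close>, which determines the
  admissible parameters. The triples \<open>(x, l, y)\<close> then range over a compact set.\<close>

lemma v_phi_uniformly_continuous: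
  fixes v :: "real^'n \<Rightarrow> real"
  assumes K: "compact K" "K \<subseteq> U" "open U" "continuous_on U v"
    and J: "open J" "1 \<in> J" "continuous_on J \<phi>"
  obtains \<epsilon> where "\<epsilon> > 0" "cball 1 \<epsilon> \<subseteq> J"
    "\<And>x l y. norm x \<le> \<epsilon> \<Longrightarrow> \<bar>l - 1\<bar> \<le> \<epsilon> \<Longrightarrow> y \<in> K \<Longrightarrow> x + l *\<^sub>R y \<in> U"
    "\<And>\<eta>. \<eta> > 0 \<Longrightarrow> \<exists>\<delta>>0. \<forall>x l x' l' y. norm x \<le> \<epsilon> \<longrightarrow> \<bar>l - 1\<bar> \<le> \<epsilon> \<longrightarrow> norm x' \<le> \<epsilon> \<longrightarrow> \<bar>l' - 1\<bar> \<le> \<epsilon>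
        \<longrightarrow> norm (x - x') < \<delta> \<longrightarrow> \<bar>l - l'\<bar> < \<delta> \<longrightarrow> y \<in> K \<longrightarrow> \<bar>v_phi \<phi> v x l y - v_phi \<phi> v x' l' y\<bar> < \<eta>"
proof -
  obtain e where e: "e > 0" "(\<Union>x\<in>K. cball x e) \<subseteq> U"
    using compact_subset_open_imp_cball_epsilon_subset[OF K(1,3,2)] by blast
  obtain B where B: "B > 0" "\<And>y. y \<in> K \<Longrightarrow> norm y \<le> B"
    using compact_imp_bounded[OF K(1)] bounded_pos by metis
  obtain e1 where e1: "e1 > 0" "cball 1 e1 \<subseteq> J" using J open_contains_cball by blast
  define \<epsilon> where "\<epsilon> = min e1 (e / (1 + B))"
  have \<epsilon>: "\<epsilon> > 0" "\<epsilon> \<le> e1" using e(1) e1(1) B(1) by (auto simp: \<epsilon>_def)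
  have "\<epsilon> \<le> e / (1 + B)" by (simp add: \<epsilon>_def)
  hence \<epsilon>e: "\<epsilon> * (1 + B) \<le> e" using B(1) by (simp add: pos_le_divide_eq)
  have J\<epsilon>: "cball 1 \<epsilon> \<subseteq> J" using e1(2) \<epsilon>(2) by force
  have inU: "x + l *\<^sub>R y \<in> U" if "norm x \<le> \<epsilon>" "\<bar>l - 1\<bar> \<le> \<epsilon>" "y \<in> K" for x l y
  proof -
    have "norm (x + (l - 1) *\<^sub>R y) \<le> norm x + \<bar>l - 1\<bar> * norm y" by (rule norm_triangle_le) simp
    also have "\<dots> \<le> \<epsilon> + \<epsilon> * B" using that B(2)[OF that(3)] \<epsilon>(1) by (intro add_mono mult_mono) auto
    also have "\<dots> \<le> e" using \<epsilon>e by (simp add: algebra_simps)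
    finally have "norm (y - (x + l *\<^sub>R y)) \<le> e"
      by (simp add: norm_minus_commute[of y] algebra_simps)
    hence "x + l *\<^sub>R y \<in> cball y e" by (simp add: dist_norm)
    thus ?thesis using e(2) that(3) by blast
  qed
  define f where "f = (\<lambda>(x, l, y). v_phi \<phi> v x l y)"
  define P where "P = cball (0::real^'n) \<epsilon> \<times> cball (1::real) \<epsilon> \<times> K"
  have "compact P" unfolding P_def using K(1) by (intro compact_Times) auto
  have "continuous_on P f"
  proof -
    have "continuous_on P (\<lambda>z. \<phi> (fst (snd z)))"
      by (rule continuous_on_compose2[OF J(3)]) (use J\<epsilon> in \<open>auto simp: P_def intro!: continuous_intros\<close>)
    moreover have "continuous_on P (\<lambda>z. v (fst z + fst (snd z) *\<^sub>R snd (snd z)))"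
      by (rule continuous_on_compose2[OF K(4)])
         (use inU in \<open>auto simp: P_def dist_real_def abs_minus_commute intro!: continuous_intros\<close>)
    ultimately show ?thesis
      unfolding f_def v_phi_def case_prod_beta by (rule continuous_on_mult)
  qed
  hence uc: "uniformly_continuous_on P f" using \<open>compact P\<close> compact_uniformly_continuous by blast
  have "\<exists>\<delta>>0. \<forall>x l x' l' y. norm x \<le> \<epsilon> \<longrightarrow> \<bar>l - 1\<bar> \<le> \<epsilon> \<longrightarrow> norm x' \<le> \<epsilon> \<longrightarrow> \<bar>l' - 1\<bar> \<le> \<epsilon>
        \<longrightarrow> norm (x - x') < \<delta> \<longrightarrow> \<bar>l - l'\<bar> < \<delta> \<longrightarrow> y \<in> K \<longrightarrow> \<bar>v_phi \<phi> v x l y - v_phi \<phi> v x' l' y\<bar> < \<eta>"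
    if \<eta>: "\<eta> > 0" for \<eta>
  proof -
    obtain d where d: "d > 0" "\<And>z z'. z \<in> P \<Longrightarrow> z' \<in> P \<Longrightarrow> dist z' z < d \<Longrightarrow> dist (f z') (f z) < \<eta>"
      using uc \<eta> unfolding uniformly_continuous_on_def by metis
    show ?thesis
    proof (intro exI[of _ "d/2"] conjI allI impI)
      fix x x' :: "real^'n" and l l' y
      assume a: "norm x \<le> \<epsilon>" "\<bar>l - 1\<bar> \<le> \<epsilon>" "norm x' \<le> \<epsilon>" "\<bar>l' - 1\<bar> \<le> \<epsilon>"
        "norm (x - x') < d/2" "\<bar>l - l'\<bar> < d/2" "y \<in> K"
      have "dist (x, l, y) (x', l', y) \<le> dist x x' + dist l l'"
        using sqrt_sum_squares_le_sum[of "dist x x'" "dist l l'"] by (simp add: dist_Pair_Pair)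
      hence "dist (x, l, y) (x', l', y) < d" using a by (simp add: dist_norm)
      hence "dist (f (x, l, y)) (f (x', l', y)) < \<eta>"
        using a by (intro d(2)) (auto simp: P_def dist_real_def abs_minus_commute)
      thus "\<bar>v_phi \<phi> v x l y - v_phi \<phi> v x' l' y\<bar> < \<eta>" by (simp add: f_def dist_real_def)
    qed (use d in simp)
  qed
  thus ?thesis using that \<epsilon>(1) J\<epsilon> inU by blast
qed

text \<open>A continuity argument in the parameter: the infimum of \<open>f - w l\<close> depends continuously on \<open>l\<close>, is
  positive at \<open>b\<close> and nowhere zero in between, hence it cannot be negative at \<open>a\<close>.\<close>

lemma nonneg_of_infimum_path:
  fixes f :: "'a \<Rightarrow> real" and w :: "real \<Rightarrow> 'a \<Rightarrow> real" and a b :: real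
  assumes A: "A \<noteq> {}" and ab: "a \<le> b"
    and cont: "\<And>l \<eta>. l \<in> {a..b} \<Longrightarrow> \<eta> > 0 \<Longrightarrow>
        \<exists>\<delta>>0. \<forall>l'\<in>{a..b}. \<bar>l' - l\<bar> < \<delta> \<longrightarrow> (\<forall>y\<in>A. \<bar>w l' y - w l y\<bar> < \<eta>)"
    and bdd: "\<And>l. l \<in> {a..b} \<Longrightarrow> bdd_below ((\<lambda>y. f y - w l y) ` A)"
    and nz: "\<And>l. a < l \<Longrightarrow> l \<le> b \<Longrightarrow> (INF y\<in>A. f y - w l y) \<noteq> 0"
    and pos: "(INF y\<in>A. f y - w b y) > 0"
    and y: "y \<in> A"
  shows "w a y \<le> f y"
proof -
  define I where "I l = (INF y\<in>A. f y - w l y)" for l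
  have le: "I l' \<le> I l + \<eta>" if "l \<in> {a..b}" "l' \<in> {a..b}" "\<forall>y\<in>A. \<bar>w l' y - w l y\<bar> < \<eta>" for l l' \<eta>
  proof -
    have "I l' - \<eta> \<le> I l"
      unfolding I_def[of l]
    proof (rule cINF_greatest[OF A])
      fix z assume z: "z \<in> A"
      have "I l' \<le> f z - w l' z" unfolding I_def by (rule cINF_lower[OF bdd[OF that(2)] z])
      thus "I l' - \<eta> \<le> f z - w l z" using that(3) z by (smt (verit))
    qed
    thus ?thesis by simp
  qed
  have "continuous_on {a..b} I"
    unfolding continuous_on_iff
  proof (intro ballI allI impI)
    fix l and \<eta> :: real assume l: "l \<in> {a..b}" "\<eta> > 0"
    obtain \<delta> where d: "\<delta> > 0" "\<And>l'. l' \<in> {a..b} \<Longrightarrow> \<bar>l' - l\<bar> < \<delta> \<Longrightarrow> \<forall>y\<in>A. \<bar>w l' y - w l y\<bar> < \<eta>/2"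
      using cont[OF l(1), of "\<eta>/2"] l(2) by auto
    show "\<exists>d>0. \<forall>l'\<in>{a..b}. dist l' l < d \<longrightarrow> dist (I l') (I l) < \<eta>"
    proof (intro exI[of _ \<delta>] conjI ballI impI d(1))
      fix l' assume l': "l' \<in> {a..b}" "dist l' l < \<delta>"
      have 1: "\<forall>y\<in>A. \<bar>w l' y - w l y\<bar> < \<eta>/2" using d(2)[OF l'(1)] l'(2) by (simp add: dist_real_def)
      hence 2: "\<forall>y\<in>A. \<bar>w l y - w l' y\<bar> < \<eta>/2" by (simp add: abs_minus_commute)
      show "dist (I l') (I l) < \<eta>"
        using le[OF l(1) l'(1) 1] le[OF l'(1) l(1) 2] l(2) by (simp add: dist_real_def)
    qed
  qed
  have "I a \<ge> 0"
  proof (rule ccontr)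
    assume neg: "\<not> I a \<ge> 0"
    then obtain l where "a \<le> l" "l \<le> b" "I l = 0"
      using IVT'[of I a 0 b] pos ab \<open>continuous_on {a..b} I\<close> by (auto simp: I_def)
    thus False using nz[of l] neg by (cases "l = a") (auto simp: I_def)
  qed
  also have "I a \<le> f y - w a y" unfolding I_def by (rule cINF_lower[OF bdd y]) (use ab in auto)
  finally show ?thesis by simp
qed

text \<open>The radius \<open>\<tau>\<close> keeps \<open>c / s\<close> inside the domain of a homeomorphic local inverse, outside of which
  the integrand need not be continuous; \<open>\<tau> < c\<close> keeps \<open>s\<close> away from the pole at \<open>0\<close>.\<close>

lemma psi_has_derivative:
  assumes g: "is_local_inverse \<phi> 1 (local_inverse \<phi> 1)" and \<phi>1: "\<phi> 1 = 1" and c: "c > 0"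
  obtains \<tau> where "\<tau> > 0" "\<tau> < c"
    "\<And>s. \<bar>s - c\<bar> < \<tau> \<Longrightarrow>
      (psi \<phi> c has_real_derivative c / s * local_inverse \<phi> 1 (c / s)) (at s)"
proof -
  obtain A B where AB: "open A" "open B" "1 \<in> A" "homeomorphism A B \<phi> (local_inverse \<phi> 1)"
    using g unfolding is_local_inverse_def by blast
  have "1 \<in> B" using AB(3,4) \<phi>1 unfolding homeomorphism_def by (metis imageI)
  have "isCont (\<lambda>s. c / s) c" using c by (intro continuous_intros) auto
  hence "\<forall>\<^sub>F s in nhds c. c / s \<in> B"
    using topological_tendstoD[of "\<lambda>s. c / s" 1 "at c" B] AB(2) \<open>1 \<in> B\<close> c
    by (simp add: isCont_def eventually_nhds_conv_at)
  then obtain e where e: "e > 0" "\<And>s. \<bar>s - c\<bar> < e \<Longrightarrow> c / s \<in> B"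
    unfolding eventually_nhds_metric by (auto simp: dist_real_def)
  define \<tau> where "\<tau> = min e c / 2"
  have \<tau>: "\<tau> > 0" "\<tau> < c" "\<tau> < e" using e(1) c by (auto simp: \<tau>_def)
  have cont: "continuous_on {c - \<tau>..c + \<tau>} (\<lambda>s. c / s * local_inverse \<phi> 1 (c / s))"
  proof (intro continuous_intros)
    show "continuous_on {c - \<tau>..c + \<tau>} (\<lambda>s. local_inverse \<phi> 1 (c / s))"
      by (rule continuous_on_compose2[of B "local_inverse \<phi> 1"])
         (use AB(4) e(2) \<tau> in \<open>auto simp: homeomorphism_def intro!: continuous_intros\<close>)
  qed (use \<tau> in auto)
  show ?thesis
  proof (rule that[OF \<tau>(1,2)])
    fix s assume s: "\<bar>s - c\<bar> < \<tau>"
    have "((\<lambda>u. LBINT y=c..u. c / y * local_inverse \<phi> 1 (c / y)) has_vector_derivative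
        c / s * local_inverse \<phi> 1 (c / s)) (at s within {c - \<tau>..c + \<tau>})"
      by (rule interval_integral_FTC2[OF _ _ cont]) (use s \<tau> in auto)
    moreover have "at s within {c - \<tau>..c + \<tau>} = at s"
      using s by (intro at_within_interior) (auto simp: abs_less_iff)
    ultimately show "(psi \<phi> c has_real_derivative c / s * local_inverse \<phi> 1 (c / s)) (at s)"
      by (simp add: psi_def[abs_def] has_real_derivative_iff_has_vector_derivative)
  qed
qed

lemma psi_self: "psi \<phi> c c = 0"
  by (simp add: psi_def)

section \<open>Dilations below the supersolution\<close>

text \<open>The situation to be analysed: the hypotheses of the theorem together with \<open>low\<close>, which expresses
  that the lower limit of \<open>u - v\<close> at the origin is zero rather than positive.\<close>

locale dilation_family =
  fixes \<Omega> U W :: "(real^'n) set" and u v :: "real^'n \<Rightarrow> real"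
    and \<phi> :: "real \<Rightarrow> real" and J :: "real set" and \<epsilon>\<^sub>3 :: real
  assumes dim: "CARD('n) \<ge> 2"
    and \<Omega>: "open \<Omega>" "bounded \<Omega>" "0 \<in> \<Omega>"
    and J: "open J" "1 \<in> J"
    and \<phi>: "\<phi> C1_differentiable_on J" "\<phi> 1 = 1" "deriv \<phi> 1 < 0"
    and u: "continuous_on (closure \<Omega> - {0}) u"
    and U: "open U" "closure \<Omega> \<subseteq> U" "continuous_on U v"
    and W: "open W" "0 \<in> W" "Ck_on 1 W v"
    and v_pos: "\<And>x. x \<in> closure \<Omega> \<Longrightarrow> v x > 0"
    and u_gt_v: "\<And>x. x \<in> closure \<Omega> - {0} \<Longrightarrow> u x > v x"
    and superharmonic: "distr_laplacian_nonpos_on (\<Omega> - {0}) u"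
    and \<epsilon>3: "\<epsilon>\<^sub>3 > 0"
    and touch: "\<And>x l. norm x < \<epsilon>\<^sub>3 \<Longrightarrow> \<bar>l - 1\<bar> < \<epsilon>\<^sub>3 \<Longrightarrow>
           (INF y\<in>\<Omega> - {0}. ereal (u y - v_phi \<phi> v x l y)) = 0 \<Longrightarrow>
           Liminf (at 0) (\<lambda>y. ereal (u y - v_phi \<phi> v x l y)) = 0"
    and low: "\<And>\<epsilon> d. \<epsilon> > 0 \<Longrightarrow> d > 0 \<Longrightarrow> \<exists>x. x \<noteq> 0 \<and> norm x < d \<and> u x < v 0 + \<epsilon>"
begin

abbreviation g :: "real \<Rightarrow> real" where "g \<equiv> local_inverse \<phi> 1"

lemma \<Omega>_sub: "\<Omega> \<subseteq> closure \<Omega>"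
  by (rule closure_subset)

lemma c_pos: "v 0 > 0"
  using v_pos \<Omega>(3) \<Omega>_sub by blast

lemma \<phi>_deriv:
  obtains D where "\<And>x. x \<in> J \<Longrightarrow> (\<phi> has_real_derivative D x) (at x)" "continuous_on J D"
    "D 1 = deriv \<phi> 1"
proof -
  obtain D where D: "\<And>x. x \<in> J \<Longrightarrow> (\<phi> has_real_derivative D x) (at x)" "continuous_on J D"
    using \<phi>(1) unfolding C1_differentiable_on_def
    by (auto simp: has_real_derivative_iff_has_vector_derivative)
  moreover have "D 1 = deriv \<phi> 1" using D(1)[OF J(2)] by (simp add: DERIV_imp_deriv)
  ultimately show ?thesis using that by blast
qed

lemma \<phi>_continuous: "continuous_on J \<phi>"
proof -
  obtain D where "\<And>x. x \<in> J \<Longrightarrow> (\<phi> has_real_derivative D x) (at x)" using \<phi>_deriv by blast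
  thus ?thesis by (meson DERIV_isCont continuous_at_imp_continuous_on)
qed

lemma \<phi>_decreasing:
  obtains a e where "a > 0" "e > 0"
    "\<And>l l'. \<bar>l - 1\<bar> < e \<Longrightarrow> \<bar>l' - 1\<bar> < e \<Longrightarrow> l < l' \<Longrightarrow> \<phi> l' \<le> \<phi> l - a * (l' - l)"
proof -
  obtain D where D: "\<And>x. x \<in> J \<Longrightarrow> (\<phi> has_real_derivative D x) (at x)" "continuous_on J D"
    "D 1 = deriv \<phi> 1" using \<phi>_deriv by blast
  define a where "a = - deriv \<phi> 1 / 2"
  have a: "a > 0" "D 1 < - a" using \<phi>(3) D(3) by (auto simp: a_def)
  have "open (J \<inter> D -` {..<-a})" by (rule continuous_open_preimage[OF D(2) J(1)]) auto
  moreover have "1 \<in> J \<inter> D -` {..<-a}" using a J by simp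
  ultimately obtain e where e: "e > 0" "ball 1 e \<subseteq> J \<inter> D -` {..<-a}"
    unfolding open_contains_ball by blast
  show ?thesis
  proof (rule that[OF a(1) e(1)])
    fix l l' :: real assume l: "\<bar>l - 1\<bar> < e" "\<bar>l' - 1\<bar> < e" "l < l'"
    have in_ball: "x \<in> ball 1 e" if "l \<le> x" "x \<le> l'" for x
      using that l by (auto simp: dist_real_def)
    have "(\<phi> has_real_derivative D x) (at x)" if "l \<le> x" "x \<le> l'" for x
      using D(1) e(2) in_ball[OF that] by blast
    from MVT2[OF l(3) this] obtain z where z: "l < z" "z < l'" "\<phi> l' - \<phi> l = (l' - l) * D z" by blast
    have "D z < - a" using e(2) in_ball[of z] z by auto
    hence "(l' - l) * D z \<le> (l' - l) * (- a)" using l(3) by (intro mult_left_mono) auto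
    thus "\<phi> l' \<le> \<phi> l - a * (l' - l)" using z(3) by (simp add: algebra_simps)
  qed
qed

text \<open>Near the origin the factor
  \<open>\<phi> l \<le> 1 - a (l - 1)\<close> lowers \<open>v\<close> by an amount proportional to \<open>(l - 1) v(0)\<close>, whereas replacing
  \<open>v y\<close> by \<open>v (l y)\<close> costs only \<open>O((l - 1) \<bar>y\<bar>)\<close> since \<open>v\<close> is Lipschitz there. Away from the origin
  \<open>u - v\<close> has a positive lower bound, which absorbs any small perturbation.\<close>

lemma dilation_strictly_below:
  assumes "\<epsilon> > 0"
  obtains l k where "1 < l" "l < 1 + \<epsilon>" "k > 0"
    "\<And>y. y \<in> \<Omega> - {0} \<Longrightarrow> u y - v_phi \<phi> v 0 l y \<ge> k"
proof -
  obtain a e where a: "a > 0" "e > 0" "\<And>l l'. \<bar>l - 1\<bar> < e \<Longrightarrow> \<bar>l' - 1\<bar> < e \<Longrightarrow> l < l' \<Longrightarrow> \<phi> l' \<le> \<phi> l - a * (l' - l)"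
    using \<phi>_decreasing by blast
  have "compact (closure \<Omega>)" using \<Omega>(2) by simp
  obtain \<epsilon>0 where e0: "\<epsilon>0 > 0" "cball 1 \<epsilon>0 \<subseteq> J"
    "\<And>x l y. norm x \<le> \<epsilon>0 \<Longrightarrow> \<bar>l - 1\<bar> \<le> \<epsilon>0 \<Longrightarrow> y \<in> closure \<Omega> \<Longrightarrow> x + l *\<^sub>R y \<in> U"
    "\<And>\<eta>. \<eta> > 0 \<Longrightarrow> \<exists>\<delta>>0. \<forall>x l x' l' y. norm x \<le> \<epsilon>0 \<longrightarrow> \<bar>l - 1\<bar> \<le> \<epsilon>0 \<longrightarrow> norm x' \<le> \<epsilon>0 \<longrightarrow> \<bar>l' - 1\<bar> \<le> \<epsilon>0
        \<longrightarrow> norm (x - x') < \<delta> \<longrightarrow> \<bar>l - l'\<bar> < \<delta> \<longrightarrow> y \<in> closure \<Omega> \<longrightarrow> \<bar>v_phi \<phi> v x l y - v_phi \<phi> v x' l' y\<bar> < \<eta>"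
    using v_phi_uniformly_continuous[OF \<open>compact (closure \<Omega>)\<close> U(2,1,3) J \<phi>_continuous] by metis
  obtain \<rho> C where \<rho>: "\<rho> > 0" "C \<ge> 0" "cball 0 \<rho> \<subseteq> W"
    "\<And>x y. x \<in> cball 0 \<rho> \<Longrightarrow> y \<in> cball 0 \<rho> \<Longrightarrow> \<bar>v x - v y\<bar> \<le> C * norm (x - y)"
    using Ck_on_1_locally_lipschitz[OF W] by blast
  have v0: "isCont v 0" using U \<Omega> \<Omega>_sub continuous_on_eq_continuous_at by blast
  have "\<forall>\<^sub>F y in nhds 0. v y > v 0 / 2"
    using order_tendstoD(1)[of v "v 0" "at 0" "v 0 / 2"] v0 c_pos
    by (simp add: isCont_def eventually_nhds_conv_at)
  then obtain \<rho>1 where \<rho>1: "\<rho>1 > 0" "\<And>y. norm y < \<rho>1 \<Longrightarrow> v y > v 0 / 2"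
    unfolding eventually_nhds_metric by auto
  define c where "c = v 0"
  have c: "c > 0" using c_pos by (simp add: c_def)
  \<comment> \<open>\<open>\<rho>2\<close> is so small that the Lipschitz error is at most half of the gain \<open>a c / 2\<close> per unit of
    \<open>l - 1\<close>, and \<open>2 \<rho>2\<close> leaves room for dilation by a factor up to \<open>2\<close>\<close>
  define \<rho>2 where "\<rho>2 = min (min (\<rho>/2) (\<rho>1/4)) (a * c / (4 * (C + 1)))"
  have \<rho>2: "\<rho>2 > 0" "2 * \<rho>2 \<le> \<rho>" "2 * \<rho>2 < \<rho>1" "\<rho>2 \<le> a * c / (4 * (C + 1))"
    using \<rho>(1,2) \<rho>1(1) a(1) c by (auto simp: \<rho>2_def)
  have C\<rho>: "C * \<rho>2 \<le> a * c / 4"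
  proof -
    have "(C + 1) * \<rho>2 \<le> a * c / 4" using \<rho>2(4) \<rho>(2) by (simp add: field_simps)
    moreover have "C * \<rho>2 \<le> (C + 1) * \<rho>2" using \<rho>2(1) by (intro mult_right_mono) auto
    ultimately show ?thesis by linarith
  qed
  define K where "K = closure \<Omega> - ball 0 \<rho>2"
  have K: "compact K" unfolding K_def by (intro compact_diff \<open>compact (closure \<Omega>)\<close>) auto
  have K0: "K \<subseteq> closure \<Omega> - {0}" using \<rho>2(1) by (auto simp: K_def)
  obtain \<gamma> where \<gamma>: "\<gamma> > 0" "\<And>y. y \<in> K \<Longrightarrow> u y - v y \<ge> \<gamma>"
  proof (cases "K = {}")
    case True thus ?thesis using that[of 1] by simp
  next
    case False
    have "continuous_on K (\<lambda>y. u y - v y)"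
      by (intro continuous_intros continuous_on_subset[OF u] continuous_on_subset[OF U(3)])
         (use K0 U(2) in auto)
    then obtain z where z: "z \<in> K" "\<And>y. y \<in> K \<Longrightarrow> u z - v z \<le> u y - v y"
      using continuous_attains_inf[OF K False] by blast
    show ?thesis using that[of "u z - v z"] z u_gt_v[of z] K0 by auto
  qed
  obtain \<delta> where \<delta>: "\<delta> > 0" "\<And>l y. \<bar>l - 1\<bar> \<le> \<epsilon>0 \<Longrightarrow> \<bar>l - 1\<bar> < \<delta> \<Longrightarrow> y \<in> closure \<Omega> \<Longrightarrow>
      \<bar>v_phi \<phi> v 0 l y - v_phi \<phi> v 0 1 y\<bar> < \<gamma>/2"
  proof -
    obtain \<delta> where d: "\<delta> > 0" "\<forall>x l x' l' y. norm x \<le> \<epsilon>0 \<longrightarrow> \<bar>l - 1\<bar> \<le> \<epsilon>0 \<longrightarrow> norm x' \<le> \<epsilon>0 \<longrightarrow> \<bar>l' - 1\<bar> \<le> \<epsilon>0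
        \<longrightarrow> norm (x - x') < \<delta> \<longrightarrow> \<bar>l - l'\<bar> < \<delta> \<longrightarrow> y \<in> closure \<Omega> \<longrightarrow> \<bar>v_phi \<phi> v x l y - v_phi \<phi> v x' l' y\<bar> < \<gamma>/2"
      using e0(4)[of "\<gamma>/2"] \<gamma>(1) by auto
    show ?thesis
    proof (rule that[OF d(1)])
      fix l y assume "\<bar>l - 1\<bar> \<le> \<epsilon>0" "\<bar>l - 1\<bar> < \<delta>" "y \<in> closure \<Omega>"
      thus "\<bar>v_phi \<phi> v 0 l y - v_phi \<phi> v 0 1 y\<bar> < \<gamma>/2"
        using d(2)[rule_format, of 0 l 0 1 y] e0(1) d(1) by simp
    qed
  qed
  have "1 / a > 0" using a(1) by simp
  \<comment> \<open>\<open>h < 1/a\<close> keeps the factor \<open>1 - a h\<close> positive\<close>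
  define m where "m = min (min \<epsilon> e) (min (min \<epsilon>0 \<delta>) (min 1 (1/a)))"
  have m: "m \<le> \<epsilon>" "m \<le> e" "m \<le> \<epsilon>0" "m \<le> \<delta>" "m \<le> 1" "m \<le> 1/a"
    unfolding m_def by (simp_all add: min_le_iff_disj)
  have "m > 0" using assms a(2) e0(1) \<delta>(1) \<open>1 / a > 0\<close> by (simp add: m_def)
  define h where "h = m / 2"
  have h: "h > 0" "h < \<epsilon>" "h < e" "h < \<epsilon>0" "h < \<delta>" "h < 1" "h < 1/a"
    using m \<open>m > 0\<close> unfolding h_def by linarith+
  define l where "l = 1 + h"
  define k where "k = min (h * (a * c / 4)) (\<gamma>/2)"
  show ?thesis
  proof (rule that[of l k])
    show "1 < l" "l < 1 + \<epsilon>" using h by (auto simp: l_def)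
    show "k > 0" using h a c \<gamma> by (simp add: k_def)
    fix y assume y: "y \<in> \<Omega> - {0}"
    hence yc: "y \<in> closure \<Omega>" using \<Omega>_sub by auto
    have uv: "u y > v y" using u_gt_v y yc by auto
    show "u y - v_phi \<phi> v 0 l y \<ge> k"
    proof (cases "norm y \<le> \<rho>2")
      case True
      have \<phi>l: "\<phi> l \<le> 1 - a * h" using a(3)[of 1 l] h a(2) \<phi>(2) by (simp add: l_def)
      have ah: "a * h < 1" using h(7) a(1) by (simp add: field_simps)
      have "norm (l *\<^sub>R y) \<le> 2 * \<rho>2" using True h \<rho>2(1) by (auto simp: l_def intro!: mult_mono)
      hence "\<bar>v (l *\<^sub>R y) - v y\<bar> \<le> C * norm (l *\<^sub>R y - y)"
        using True \<rho>2(1,2) by (intro \<rho>(4)) auto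
      also have "l *\<^sub>R y - y = h *\<^sub>R y" by (simp add: l_def algebra_simps)
      also have "C * norm (h *\<^sub>R y) \<le> C * (h * \<rho>2)"
        using True h \<rho>(2) by (intro mult_left_mono) auto
      also have "\<dots> = h * (C * \<rho>2)" by simp
      also have "\<dots> \<le> h * (a * c / 4)" using C\<rho> h by (intro mult_left_mono) auto
      finally have vl: "v (l *\<^sub>R y) \<le> v y + h * (a * c / 4)" by linarith
      have vpos: "v (l *\<^sub>R y) > 0"
        using \<rho>1(2)[of "l *\<^sub>R y"] \<open>norm (l *\<^sub>R y) \<le> 2 * \<rho>2\<close> \<rho>2(3) c_pos by linarith
      have "\<phi> l * v (l *\<^sub>R y) \<le> (1 - a * h) * v (l *\<^sub>R y)" using \<phi>l vpos by (intro mult_right_mono) auto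
      also have "\<dots> \<le> (1 - a * h) * (v y + h * (a * c / 4))" using vl ah by (intro mult_left_mono) auto
      also have "\<dots> \<le> v y - h * (a * v y) + h * (a * c / 4)"
        using h a c by (simp add: algebra_simps)
      also have "\<dots> \<le> v y - h * (a * (c / 2)) + h * (a * c / 4)"
      proof -
        have "h * (a * (c / 2)) \<le> h * (a * v y)"
          using \<rho>1(2)[of y] True \<rho>2(1,3) h a by (intro mult_left_mono) (auto simp: c_def)
        thus ?thesis by linarith
      qed
      also have "\<dots> = v y - h * (a * c / 4)" by (simp add: field_simps)
      finally have "\<phi> l * v (l *\<^sub>R y) \<le> v y - h * (a * c / 4)" .
      thus ?thesis using uv unfolding v_phi_def k_def by simp
    next
      case False
      hence "u y - v y \<ge> \<gamma>" using yc by (intro \<gamma>(2)) (auto simp: K_def)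
      moreover have "\<bar>v_phi \<phi> v 0 l y - v_phi \<phi> v 0 1 y\<bar> < \<gamma>/2"
        using h by (intro \<delta>(2) yc) (auto simp: l_def)
      moreover have "v_phi \<phi> v 0 1 y = v y" by (simp add: v_phi_def \<phi>(2))
      ultimately show ?thesis unfolding k_def by linarith
    qed
  qed
qed

lemma v_isCont: "x \<in> closure \<Omega> \<Longrightarrow> isCont v x"
  using U continuous_on_eq_continuous_at by blast

text \<open>The equation \<open>\<phi> l = v 0 / v x\<close> selects the dilation whose value at the origin is exactly \<open>v 0\<close>. One
  starts from a dilation strictly below \<open>u\<close> with parameter \<open>l0 > 1\<close> and decreases the parameter. As long as \<open>l\<close> exceeds the final value, \<open>\<phi> l * v x < v 0\<close>, so the lower limit of the
  difference at the origin is positive; by hypothesis the infimum of the difference then cannot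
  vanish, and it stays positive by continuity. The neighbourhoods \<open>A\<close> and \<open>B\<close> record where \<open>g\<close> inverts
  \<open>\<phi>\<close>.\<close>

lemma touching_dilation:
  obtains A B where "open A" "open B" "1 \<in> A" "1 \<in> B" "homeomorphism A B \<phi> g" "g 1 = 1"
    "\<forall>\<^sub>F x in nhds 0. x \<in> \<Omega> \<and> x \<in> W \<and> v 0 / v x \<in> B \<and>
        (\<forall>y\<in>\<Omega> - {0}. v_phi \<phi> v x (g (v 0 / v x)) y \<le> u y)"
proof -
  have linv: "is_local_inverse \<phi> 1 g"
    by (rule is_local_inverse_local_inverse[OF J \<phi>(1)]) (use \<phi>(3) in simp)
  then obtain A B where AB: "open A" "open B" "1 \<in> A" "homeomorphism A B \<phi> g"
    unfolding is_local_inverse_def by blast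
  have B1: "1 \<in> B" and g1: "g 1 = 1"
    using AB(3,4) \<phi>(2) unfolding homeomorphism_def by (metis imageI)+
  have \<phi>g: "\<phi> (g s) = s" if "s \<in> B" for s using AB(4) that by (simp add: homeomorphism_def)
  obtain a e where a: "a > 0" "e > 0" "\<And>l l'. \<bar>l - 1\<bar> < e \<Longrightarrow> \<bar>l' - 1\<bar> < e \<Longrightarrow> l < l' \<Longrightarrow> \<phi> l' \<le> \<phi> l - a * (l' - l)"
    using \<phi>_decreasing by blast
  have cl: "compact (closure \<Omega>)" using \<Omega>(2) by simp
  obtain \<epsilon>0 where e0: "\<epsilon>0 > 0" "cball 1 \<epsilon>0 \<subseteq> J"
    "\<And>x l y. norm x \<le> \<epsilon>0 \<Longrightarrow> \<bar>l - 1\<bar> \<le> \<epsilon>0 \<Longrightarrow> y \<in> closure \<Omega> \<Longrightarrow> x + l *\<^sub>R y \<in> U"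
    "\<And>\<eta>. \<eta> > 0 \<Longrightarrow> \<exists>\<delta>>0. \<forall>x l x' l' y. norm x \<le> \<epsilon>0 \<longrightarrow> \<bar>l - 1\<bar> \<le> \<epsilon>0 \<longrightarrow> norm x' \<le> \<epsilon>0 \<longrightarrow> \<bar>l' - 1\<bar> \<le> \<epsilon>0
        \<longrightarrow> norm (x - x') < \<delta> \<longrightarrow> \<bar>l - l'\<bar> < \<delta> \<longrightarrow> y \<in> closure \<Omega> \<longrightarrow> \<bar>v_phi \<phi> v x l y - v_phi \<phi> v x' l' y\<bar> < \<eta>"
    using v_phi_uniformly_continuous[OF cl U(2,1,3) J \<phi>_continuous] by metis
  define \<epsilon> where "\<epsilon> = min e (min \<epsilon>0 \<epsilon>\<^sub>3)"
  have \<epsilon>: "\<epsilon> > 0" "\<epsilon> \<le> e" "\<epsilon> \<le> \<epsilon>0" "\<epsilon> \<le> \<epsilon>\<^sub>3" using a(2) e0(1) \<epsilon>3 by (auto simp: \<epsilon>_def)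
  obtain l0 k where l0: "1 < l0" "l0 < 1 + \<epsilon>" "k > 0"
    "\<And>y. y \<in> \<Omega> - {0} \<Longrightarrow> u y - v_phi \<phi> v 0 l0 y \<ge> k"
    using dilation_strictly_below[OF \<epsilon>(1)] by metis
  obtain \<delta> where \<delta>: "\<delta> > 0" "\<forall>x l x' l' y. norm x \<le> \<epsilon>0 \<longrightarrow> \<bar>l - 1\<bar> \<le> \<epsilon>0 \<longrightarrow> norm x' \<le> \<epsilon>0 \<longrightarrow> \<bar>l' - 1\<bar> \<le> \<epsilon>0
        \<longrightarrow> norm (x - x') < \<delta> \<longrightarrow> \<bar>l - l'\<bar> < \<delta> \<longrightarrow> y \<in> closure \<Omega> \<longrightarrow> \<bar>v_phi \<phi> v x l y - v_phi \<phi> v x' l' y\<bar> < k/2"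
    using e0(4)[of "k/2"] l0(3) by auto
  have ne: "\<Omega> - {0} \<noteq> {}"
  proof
    assume "\<Omega> - {0} = {}"
    hence "open {0::real^'n}" using \<Omega> by (metis Diff_eq_empty_iff insert_absorb subset_singletonD empty_iff)
    thus False using not_open_singleton by blast
  qed
  have c: "v 0 > 0" by (rule c_pos)
  have lim_v: "(v \<longlongrightarrow> v 0) (nhds 0)"
    using v_isCont \<Omega>(3) \<Omega>_sub by (auto simp: isCont_def tendsto_at_iff_tendsto_nhds)
  have "((\<lambda>x. v 0 / v x) \<longlongrightarrow> v 0 / v 0) (nhds 0)" using c by (intro tendsto_intros lim_v) auto
  hence lim_q: "((\<lambda>x. v 0 / v x) \<longlongrightarrow> 1) (nhds 0)" using c by simp
  have "isCont g 1" using AB B1 by (auto simp: homeomorphism_def continuous_on_eq_continuous_at)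
  hence lim_g: "((\<lambda>x. g (v 0 / v x)) \<longlongrightarrow> 1) (nhds 0)"
    using isCont_tendsto_compose[OF _ lim_q, of g] g1 by simp
  have "\<forall>\<^sub>F x in nhds 0. v 0 / v x \<in> B" using topological_tendstoD[OF lim_q AB(2) B1] .
  moreover have "\<forall>\<^sub>F x in nhds 0. g (v 0 / v x) < l0" using order_tendstoD(2)[OF lim_g l0(1)] .
  moreover have "\<forall>\<^sub>F x in nhds 0. g (v 0 / v x) > 1 - \<epsilon>"
    by (rule order_tendstoD(1)[OF lim_g]) (use \<epsilon>(1) in simp)
  moreover have "\<forall>\<^sub>F x in nhds 0. x \<in> \<Omega>" "\<forall>\<^sub>F x in nhds 0. x \<in> W"
    using eventually_nhds_in_open \<Omega> W by blast+
  moreover have "\<forall>\<^sub>F x in nhds (0::real^'n). x \<in> ball 0 (min \<delta> \<epsilon>)"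
    by (rule eventually_nhds_in_open) (use \<delta> \<epsilon> in auto)
  ultimately have ev: "\<forall>\<^sub>F x in nhds 0. x \<in> \<Omega> \<and> x \<in> W \<and> v 0 / v x \<in> B \<and>
        (\<forall>y\<in>\<Omega> - {0}. v_phi \<phi> v x (g (v 0 / v x)) y \<le> u y)"
  proof eventually_elim
    case (elim x)
    define lx where "lx = g (v 0 / v x)"
    have lx: "lx < l0" "lx > 1 - \<epsilon>" "\<phi> lx = v 0 / v x" using elim \<phi>g by (auto simp: lx_def)
    have x: "norm x < \<delta>" "norm x < \<epsilon>" using elim by auto
    have xO: "x \<in> \<Omega>" using elim by blast
    have vx: "v x > 0" using elim v_pos \<Omega>_sub by blast
    have lr: "\<bar>l - 1\<bar> < \<epsilon>" if "l \<in> {lx..l0}" for l using that lx l0 by auto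
    have bdd: "bdd_below ((\<lambda>y. u y - v_phi \<phi> v x l y) ` (\<Omega> - {0}))" if l: "l \<in> {lx..l0}" for l
    proof -
      have "continuous_on (closure \<Omega>) (v_phi \<phi> v x l)"
        unfolding v_phi_def
        by (intro continuous_intros continuous_on_compose2[OF U(3)])
           (use x(2) \<epsilon>(3) lr[OF l] in \<open>auto intro!: e0(3)\<close>)
      hence "compact (v_phi \<phi> v x l ` closure \<Omega>)" using cl compact_continuous_image by blast
      then obtain M where M: "\<And>y. y \<in> closure \<Omega> \<Longrightarrow> \<bar>v_phi \<phi> v x l y\<bar> \<le> M"
        using compact_imp_bounded bounded_real by (metis (no_types, lifting) image_eqI)
      show ?thesis
      proof (rule bdd_belowI2)
        fix y assume "y \<in> \<Omega> - {0}"
        hence "y \<in> closure \<Omega> - {0}" using \<Omega>_sub by auto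
        thus "- M \<le> u y - v_phi \<phi> v x l y" using M[of y] u_gt_v[of y] v_pos[of y] by auto
      qed
    qed
    have "v_phi \<phi> v x lx y \<le> u y" if y: "y \<in> \<Omega> - {0}" for y
    proof (rule nonneg_of_infimum_path[where A = "\<Omega> - {0}" and f = u and w = "v_phi \<phi> v x" and a = lx and b = l0 and y = y, OF ne _ _ _ _ _ y])
      show "lx \<le> l0" using lx by simp
    next
      fix l \<eta> assume l: "l \<in> {lx..l0}" and \<eta>: "(\<eta>::real) > 0"
      obtain d where d: "d > 0" "\<forall>x l x' l' y. norm x \<le> \<epsilon>0 \<longrightarrow> \<bar>l - 1\<bar> \<le> \<epsilon>0 \<longrightarrow> norm x' \<le> \<epsilon>0 \<longrightarrow> \<bar>l' - 1\<bar> \<le> \<epsilon>0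
        \<longrightarrow> norm (x - x') < d \<longrightarrow> \<bar>l - l'\<bar> < d \<longrightarrow> y \<in> closure \<Omega> \<longrightarrow> \<bar>v_phi \<phi> v x l y - v_phi \<phi> v x' l' y\<bar> < \<eta>"
        using e0(4)[OF \<eta>] by blast
      show "\<exists>\<delta>>0. \<forall>l'\<in>{lx..l0}. \<bar>l' - l\<bar> < \<delta> \<longrightarrow> (\<forall>y\<in>\<Omega> - {0}. \<bar>v_phi \<phi> v x l' y - v_phi \<phi> v x l y\<bar> < \<eta>)"
      proof (intro exI[of _ d] conjI ballI impI d(1))
        fix l' y assume "l' \<in> {lx..l0}" "\<bar>l' - l\<bar> < d" "y \<in> \<Omega> - {0}"
        thus "\<bar>v_phi \<phi> v x l' y - v_phi \<phi> v x l y\<bar> < \<eta>"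
          using d(2)[rule_format, of x l' x l y] x(2) \<epsilon>(3) lr[of l'] lr[OF l] \<Omega>_sub d(1) by auto
      qed
    next
      show "bdd_below ((\<lambda>y. u y - v_phi \<phi> v x l y) ` (\<Omega> - {0}))" if "l \<in> {lx..l0}" for l
        by (rule bdd[OF that])
    next
      fix l assume l: "lx < l" "l \<le> l0"
      hence lI: "l \<in> {lx..l0}" by simp
      have xl: "x + l *\<^sub>R 0 \<in> closure \<Omega>" using xO \<Omega>_sub by auto
      show "(INF y\<in>\<Omega> - {0}. u y - v_phi \<phi> v x l y) \<noteq> 0"
      proof
        assume I0: "(INF y\<in>\<Omega> - {0}. u y - v_phi \<phi> v x l y) = 0"
        have "(INF y\<in>\<Omega> - {0}. ereal (u y - v_phi \<phi> v x l y)) = 0"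
          using ereal_Inf'[OF bdd[OF lI]] ne I0 by (simp add: image_image zero_ereal_def)
        hence L0: "Liminf (at 0) (\<lambda>y. ereal (u y - v_phi \<phi> v x l y)) = 0"
          using x(2) \<epsilon>(4) lr[OF lI] by (intro touch) auto
        have "\<phi> l \<le> \<phi> lx - a * (l - lx)"
          using lr[OF lI] lr[of lx] lx(1) l \<epsilon>(2) by (intro a(3)) auto
        hence "\<phi> l < v 0 / v x" using a(1) l(1) lx(3) mult_pos_pos[of a "l - lx"] by linarith
        hence \<kappa>: "v 0 - \<phi> l * v x > 0" using vx by (simp add: pos_less_divide_eq)
        define \<kappa> where "\<kappa> = v 0 - \<phi> l * v x"
        have "isCont (\<lambda>y. v y - v_phi \<phi> v x l y) 0"
          unfolding v_phi_def using v_isCont[OF xl] v_isCont \<Omega>(3) \<Omega>_sub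
          by (intro continuous_intros isCont_o2[of _ "\<lambda>y. x + l *\<^sub>R y" v]) auto
        hence "((\<lambda>y. v y - v_phi \<phi> v x l y) \<longlongrightarrow> \<kappa>) (at 0)"
          by (simp add: isCont_def v_phi_def \<kappa>_def)
        hence "\<forall>\<^sub>F y in at 0. v y - v_phi \<phi> v x l y > \<kappa>/2"
          by (rule order_tendstoD(1)) (use \<kappa> in \<open>simp add: \<kappa>_def\<close>)
        moreover have "\<forall>\<^sub>F y in at 0. y \<in> \<Omega> - {0}"
          using eventually_nhds_in_open[OF \<Omega>(1,3)] by (simp add: eventually_at_filter eventually_mono)
        ultimately have "\<forall>\<^sub>F y in at 0. ereal (\<kappa>/2) \<le> ereal (u y - v_phi \<phi> v x l y)"
        proof eventually_elim
          case (elim y)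
          thus ?case using u_gt_v[of y] \<Omega>_sub by auto
        qed
        hence "ereal (\<kappa>/2) \<le> 0" using Liminf_bounded L0 by metis
        thus False using \<kappa> by (simp add: \<kappa>_def)
      qed
    next
      show "(INF y\<in>\<Omega> - {0}. u y - v_phi \<phi> v x l0 y) > 0"
      proof -
        have "k/2 \<le> (INF y\<in>\<Omega> - {0}. u y - v_phi \<phi> v x l0 y)"
        proof (rule cINF_greatest[OF ne])
          fix y assume y: "y \<in> \<Omega> - {0}"
          have "\<bar>v_phi \<phi> v x l0 y - v_phi \<phi> v 0 l0 y\<bar> < k/2"
            using \<delta>(2)[rule_format, of x l0 0 l0 y] x \<epsilon>(3) e0(1) \<delta>(1) l0(1,2) y \<Omega>_sub by auto
          thus "k/2 \<le> u y - v_phi \<phi> v x l0 y" using l0(4)[OF y] by linarith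
        qed
        thus ?thesis using l0(3) by linarith
      qed
    qed
    thus ?case using elim unfolding lx_def by blast
  qed
  show ?thesis by (rule that[OF AB(1-3) B1 AB(4) g1 ev])
qed

section \<open>The affine relation\<close>

lemma v_has_gradient: "x \<in> W \<Longrightarrow> (v has_derivative (\<lambda>h. gradient v x \<bullet> h)) (at x)"
  using W(3) by (intro has_derivative_gradient) simp

lemma punctured: "open (\<Omega> - {0})" "0 \<notin> \<Omega> - {0}" "continuous_on (\<Omega> - {0}) u"
  using \<Omega>(1) \<Omega>_sub by (auto intro: open_delete continuous_on_subset[OF u])

text \<open>Both \<open>v\<close> and the touching dilation are minorants of \<open>u\<close> with value \<open>v 0\<close> at the origin, so their
  gradients there agree. The gradient of the dilation is \<open>\<phi> l * l\<close> times the gradient of \<open>v\<close> at \<open>x\<close>.\<close>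

lemma gradient_relation:
  "\<forall>\<^sub>F x in nhds 0. x \<in> \<Omega> \<and> x \<in> W \<and>
     (v 0 / v x * g (v 0 / v x)) *\<^sub>R gradient v x = gradient v 0"
proof -
  obtain A B where AB: "open A" "open B" "1 \<in> A" "1 \<in> B" "homeomorphism A B \<phi> g"
    and ev: "\<forall>\<^sub>F x in nhds 0. x \<in> \<Omega> \<and> x \<in> W \<and> v 0 / v x \<in> B \<and>
        (\<forall>y\<in>\<Omega> - {0}. v_phi \<phi> v x (g (v 0 / v x)) y \<le> u y)"
    using touching_dilation by blast
  obtain r where r: "r > 0" "cball 0 r \<subseteq> \<Omega>" using \<Omega> open_contains_cball by blast
  show ?thesis using ev
  proof eventually_elim
    case (elim x)
    define s where "s = v 0 / v x"
    define l where "l = g s"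
    have vx: "v x > 0" using elim v_pos \<Omega>_sub by blast
    have \<phi>l: "\<phi> l = s" using elim AB(5) by (simp add: l_def s_def homeomorphism_def)
    have d: "(v_phi \<phi> v x l has_derivative (\<lambda>h. ((s * l) *\<^sub>R gradient v x) \<bullet> h)) (at 0)"
    proof -
      have 1: "((\<lambda>y. x + l *\<^sub>R y) has_derivative (\<lambda>h. l *\<^sub>R h)) (at 0)"
        by (auto intro!: derivative_eq_intros)
      have 2: "(v has_derivative (\<lambda>h. gradient v x \<bullet> h)) (at (x + l *\<^sub>R 0))"
        using v_has_gradient elim by simp
      have "((\<lambda>y. \<phi> l * v (x + l *\<^sub>R y)) has_derivative (\<lambda>h. \<phi> l * (gradient v x \<bullet> (l *\<^sub>R h)))) (at 0)"
        by (intro has_derivative_mult_right has_derivative_compose[OF 1 2])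
      thus ?thesis by (simp add: v_phi_def[abs_def] \<phi>l mult.assoc)
    qed
    have "gradient v 0 = (s * l) *\<^sub>R gradient v x"
    proof (rule distr_superharmonic_gradient_unique[OF dim r(1) punctured(1,2) _ punctured(3) superharmonic
          v_has_gradient[OF W(2)] d refl _ _ _ low])
      show "cball 0 r - {0} \<subseteq> \<Omega> - {0}" using r by auto
      show "v_phi \<phi> v x l 0 = v 0" using vx by (simp add: v_phi_def \<phi>l s_def)
      fix y :: "real^'n" assume y: "y \<noteq> 0" "norm y \<le> r"
      hence y\<Omega>: "y \<in> \<Omega> - {0}" using r by auto
      show "u y \<ge> v y" using u_gt_v[of y] y\<Omega> \<Omega>_sub by auto
      show "u y \<ge> v_phi \<phi> v x l y" using elim y\<Omega> by (simp add: l_def s_def)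
    qed
    thus ?case using elim by (simp add: s_def l_def)
  qed
qed

text \<open>The factor in the gradient relation is the derivative of \<open>psi\<close> at \<open>v x\<close>, so the relation says that
  \<open>psi \<phi> (v 0) (v x)\<close> has constant gradient.\<close>

lemma psi_eq_affine:
  "\<exists>\<epsilon>>0. \<forall>x. norm x < \<epsilon> \<longrightarrow> psi \<phi> (v 0) (v x) = gradient v 0 \<bullet> x"
proof -
  have linv: "is_local_inverse \<phi> 1 g"
    by (rule is_local_inverse_local_inverse[OF J \<phi>(1)]) (use \<phi>(3) in simp)
  obtain \<tau> where \<tau>: "\<tau> > 0" "\<tau> < v 0" "\<And>s. \<bar>s - v 0\<bar> < \<tau> \<Longrightarrow>
      (psi \<phi> (v 0) has_real_derivative v 0 / s * g (v 0 / s)) (at s)"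
    using psi_has_derivative[OF linv \<phi>(2) c_pos] by metis
  have "isCont v 0" using v_isCont \<Omega>(3) \<Omega>_sub by blast
  hence "\<forall>\<^sub>F x in nhds 0. dist (v x) (v 0) < \<tau>"
    using \<tau>(1) tendstoD[of v "v 0" "at 0" \<tau>] by (simp add: isCont_def eventually_nhds_conv_at)
  with gradient_relation have "\<forall>\<^sub>F x in nhds 0. dist (v x) (v 0) < \<tau> \<and> x \<in> W \<and>
     (v 0 / v x * g (v 0 / v x)) *\<^sub>R gradient v x = gradient v 0"
    by eventually_elim auto
  then obtain \<epsilon> where \<epsilon>: "\<epsilon> > 0" "\<And>x. norm x < \<epsilon> \<Longrightarrow> dist (v x) (v 0) < \<tau> \<and> x \<in> W \<and>
     (v 0 / v x * g (v 0 / v x)) *\<^sub>R gradient v x = gradient v 0"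
    unfolding eventually_nhds_metric by auto
  have "\<exists>k. \<forall>x\<in>ball 0 \<epsilon>. psi \<phi> (v 0) (v x) - gradient v 0 \<bullet> x = k"
  proof (rule has_derivative_zero_constant[OF convex_ball])
    fix x :: "real^'n" assume "x \<in> ball 0 \<epsilon>"
    hence x: "\<bar>v x - v 0\<bar> < \<tau>" "x \<in> W" "(v 0 / v x * g (v 0 / v x)) *\<^sub>R gradient v x = gradient v 0"
      using \<epsilon>(2)[of x] by (auto simp: dist_real_def)
    have "(psi \<phi> (v 0) has_derivative (\<lambda>h. (v 0 / v x * g (v 0 / v x)) * h)) (at (v x))"
      using \<tau>(3)[OF x(1)] unfolding has_field_derivative_def .
    from has_derivative_compose[OF v_has_gradient[OF x(2)] this]
    have "((\<lambda>x. psi \<phi> (v 0) (v x)) has_derivative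
        (\<lambda>h. (v 0 / v x * g (v 0 / v x)) * (gradient v x \<bullet> h))) (at x)" .
    also have "(\<lambda>h. (v 0 / v x * g (v 0 / v x)) * (gradient v x \<bullet> h)) = (\<lambda>h. gradient v 0 \<bullet> h)"
      by (rule ext) (metis x(3) inner_scaleR_left)
    finally have "((\<lambda>x. psi \<phi> (v 0) (v x)) has_derivative (\<lambda>h. gradient v 0 \<bullet> h)) (at x)" .
    hence "((\<lambda>x. psi \<phi> (v 0) (v x) - gradient v 0 \<bullet> x) has_derivative
        (\<lambda>h. gradient v 0 \<bullet> h - gradient v 0 \<bullet> h)) (at x)"
      by (rule has_derivative_diff) (auto intro!: derivative_eq_intros)
    thus "((\<lambda>x. psi \<phi> (v 0) (v x) - gradient v 0 \<bullet> x) has_derivative (\<lambda>h. 0)) (at x within ball 0 \<epsilon>)"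
      by (simp add: has_derivative_at_withinI)
  qed
  then obtain k where k: "\<And>x. norm x < \<epsilon> \<Longrightarrow> psi \<phi> (v 0) (v x) - gradient v 0 \<bullet> x = k" by auto
  have "k = 0" using k[of 0] \<epsilon>(1) by (simp add: psi_self)
  thus ?thesis using k \<epsilon>(1) by (intro exI[of _ \<epsilon>]) auto
qed

text \<open>If \<open>deriv \<phi> 1 < -1\<close>, then \<open>l * \<phi> l\<close> is decreasing at \<open>1\<close>, so the derivative \<open>\<phi> l * l\<close> of \<open>psi\<close>
  (with \<open>\<phi> l = v 0 / s\<close>) is below \<open>1\<close> for \<open>s > v 0\<close> and above \<open>1\<close> for \<open>s < v 0\<close>. Hence
  \<open>psi \<phi> (v 0) s \<le> s - v 0\<close>, and the affine identity makes \<open>v\<close> lie above its tangent plane at the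
  origin. Then \<open>u\<close> lies strictly above this plane although it comes arbitrarily close to it at the
  origin, which is impossible for a superharmonic function.\<close>

lemma deriv_ge_minus_1: "deriv \<phi> 1 \<ge> -1"
proof (rule ccontr)
  assume "\<not> deriv \<phi> 1 \<ge> -1"
  hence lt: "deriv \<phi> 1 + 1 < 0" by simp
  obtain D where D: "\<And>x. x \<in> J \<Longrightarrow> (\<phi> has_real_derivative D x) (at x)" "D 1 = deriv \<phi> 1"
    using \<phi>_deriv by blast
  have dm: "((\<lambda>l. \<phi> l * l) has_real_derivative deriv \<phi> 1 + 1) (at 1)"
    using DERIV_mult[OF D(1)[OF J(2)] DERIV_ident] D(2) \<phi>(2) by simp
  obtain d1 where d1: "d1 > 0" "\<And>h. h > 0 \<Longrightarrow> h < d1 \<Longrightarrow> \<phi> (1 + h) * (1 + h) < 1"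
    using DERIV_neg_dec_right[OF dm lt] \<phi>(2) by auto
  obtain d2 where d2: "d2 > 0" "\<And>h. h > 0 \<Longrightarrow> h < d2 \<Longrightarrow> \<phi> (1 - h) * (1 - h) > 1"
    using DERIV_neg_dec_left[OF dm lt] \<phi>(2) by auto
  obtain a e where a: "a > 0" "e > 0" "\<And>l l'. \<bar>l - 1\<bar> < e \<Longrightarrow> \<bar>l' - 1\<bar> < e \<Longrightarrow> l < l' \<Longrightarrow> \<phi> l' \<le> \<phi> l - a * (l' - l)"
    using \<phi>_decreasing by blast
  obtain A B where AB: "open A" "open B" "1 \<in> A" "1 \<in> B" "homeomorphism A B \<phi> g" "g 1 = 1"
    using touching_dilation by metis
  define c where "c = v 0"
  have c: "c > 0" using c_pos by (simp add: c_def)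
  define f where "f s = c / s * g (c / s)" for s
  have linv: "is_local_inverse \<phi> 1 g"
    by (rule is_local_inverse_local_inverse[OF J \<phi>(1)]) (use \<phi>(3) in simp)
  obtain \<tau> where \<tau>: "\<tau> > 0" "\<tau> < c" "\<And>s. \<bar>s - c\<bar> < \<tau> \<Longrightarrow> (psi \<phi> c has_real_derivative f s) (at s)"
    using psi_has_derivative[OF linv \<phi>(2) c] unfolding f_def by metis
  have "((\<lambda>s. c / s) \<longlongrightarrow> c / c) (nhds c)" using c by (intro tendsto_intros filterlim_ident) auto
  hence lim_q: "((\<lambda>s. c / s) \<longlongrightarrow> 1) (nhds c)" using c by simp
  have "isCont g 1" using AB by (auto simp: homeomorphism_def continuous_on_eq_continuous_at)
  hence lim_g: "((\<lambda>s. g (c / s)) \<longlongrightarrow> 1) (nhds c)"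
    using isCont_tendsto_compose[OF _ lim_q, of g] AB(6) by simp
  have "\<forall>\<^sub>F s in nhds c. c / s \<in> B" using topological_tendstoD[OF lim_q AB(2,4)] .
  moreover have "\<forall>\<^sub>F s in nhds c. dist (g (c / s)) 1 < min e (min d1 d2)"
    by (rule tendstoD[OF lim_g]) (use a(2) d1(1) d2(1) in simp)
  ultimately have "\<forall>\<^sub>F s in nhds c. c / s \<in> B \<and> dist (g (c / s)) 1 < min e (min d1 d2)"
    by eventually_elim simp
  then obtain \<sigma>0 where \<sigma>0: "\<sigma>0 > 0" "\<And>s. dist s c < \<sigma>0 \<Longrightarrow> c / s \<in> B \<and> dist (g (c / s)) 1 < min e (min d1 d2)"
    unfolding eventually_nhds_metric by blast
  define \<sigma> where "\<sigma> = min \<sigma>0 \<tau>"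
  have \<sigma>: "\<sigma> > 0" "\<sigma> \<le> \<sigma>0" "\<sigma> \<le> \<tau>" using \<sigma>0(1) \<tau>(1) by (auto simp: \<sigma>_def)
  have f_right: "f s < 1" if s: "c < s" "s < c + \<sigma>" for s
  proof -
    define l where "l = g (c / s)"
    have *: "c / s \<in> B" "\<bar>l - 1\<bar> < e" "\<bar>l - 1\<bar> < d1"
      using \<sigma>0(2)[of s] s \<sigma> by (auto simp: l_def dist_real_def)
    have \<phi>l: "\<phi> l = c / s" using *(1) AB(5) by (simp add: l_def homeomorphism_def)
    have "c / s < 1" using s c by simp
    have "l > 1"
    proof (rule ccontr)
      assume "\<not> l > 1"
      moreover have "l \<noteq> 1" using \<open>c / s < 1\<close> \<phi>l \<phi>(2) by auto
      ultimately have "l < 1" by simp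
      hence "\<phi> 1 \<le> \<phi> l - a * (1 - l)" "a * (1 - l) > 0" using *(2) a(1,2) by (auto intro: a(3))
      thus False using \<phi>(2) \<phi>l \<open>c / s < 1\<close> by linarith
    qed
    hence "\<phi> l * l < 1" using d1(2)[of "l - 1"] *(3) by simp
    moreover have "f s = \<phi> l * l" unfolding f_def \<phi>l unfolding l_def ..
    ultimately show ?thesis by simp
  qed
  have f_left: "f s > 1" if s: "c - \<sigma> < s" "s < c" for s
  proof -
    define l where "l = g (c / s)"
    have s0: "s > 0" using s \<sigma> \<tau> by linarith
    have *: "c / s \<in> B" "\<bar>l - 1\<bar> < e" "\<bar>l - 1\<bar> < d2"
      using \<sigma>0(2)[of s] s \<sigma> by (auto simp: l_def dist_real_def)
    have \<phi>l: "\<phi> l = c / s" using *(1) AB(5) by (simp add: l_def homeomorphism_def)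
    have "c / s > 1" using s s0 by simp
    have "l < 1"
    proof (rule ccontr)
      assume "\<not> l < 1"
      moreover have "l \<noteq> 1" using \<open>c / s > 1\<close> \<phi>l \<phi>(2) by auto
      ultimately have "l > 1" by simp
      hence "\<phi> l \<le> \<phi> 1 - a * (l - 1)" "a * (l - 1) > 0" using *(2) a(1,2) by (auto intro: a(3))
      thus False using \<phi>(2) \<phi>l \<open>c / s > 1\<close> by linarith
    qed
    hence "\<phi> l * l > 1" using d2(2)[of "1 - l"] *(3) by simp
    moreover have "f s = \<phi> l * l" unfolding f_def \<phi>l unfolding l_def ..
    ultimately show ?thesis by simp
  qed
  have psi_le: "psi \<phi> c s \<le> s - c" if s: "\<bar>s - c\<bar> < \<sigma>" for s
  proof -
    consider "s = c" | "s > c" | "s < c" by linarith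
    thus ?thesis
    proof cases
      case 1 thus ?thesis by (simp add: psi_self)
    next
      case 2
      have "(psi \<phi> c has_real_derivative f t) (at t)" if "c \<le> t" "t \<le> s" for t
        using that s \<sigma> by (intro \<tau>(3)) auto
      from MVT2[OF 2 this] obtain z where z: "c < z" "z < s" "psi \<phi> c s - psi \<phi> c c = (s - c) * f z" by blast
      have "f z < 1" using f_right[of z] z s by auto
      hence "(s - c) * f z \<le> (s - c) * 1" using 2 by (intro mult_left_mono) auto
      thus ?thesis using z(3) by (simp add: psi_self)
    next
      case 3
      have "(psi \<phi> c has_real_derivative f t) (at t)" if "s \<le> t" "t \<le> c" for t
        using that s \<sigma> by (intro \<tau>(3)) auto
      from MVT2[OF 3 this] obtain z where z: "s < z" "z < c" "psi \<phi> c c - psi \<phi> c s = (c - s) * f z" by blast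
      have "f z > 1" using f_left[of z] z s by auto
      hence "(c - s) * 1 \<le> (c - s) * f z" using 3 by (intro mult_left_mono) auto
      thus ?thesis using z(3) by (simp add: psi_self)
    qed
  qed
  obtain \<epsilon> where \<epsilon>: "\<epsilon> > 0" "\<And>x. norm x < \<epsilon> \<Longrightarrow> psi \<phi> c (v x) = gradient v 0 \<bullet> x"
    using psi_eq_affine unfolding c_def by blast
  have "isCont v 0" using v_isCont \<Omega>(3) \<Omega>_sub by blast
  hence "\<forall>\<^sub>F x in nhds 0. dist (v x) (v 0) < \<sigma>"
    using \<sigma>(1) tendstoD[of v "v 0" "at 0" \<sigma>] by (simp add: isCont_def eventually_nhds_conv_at)
  then obtain \<epsilon>' where \<epsilon>': "\<epsilon>' > 0" "\<And>x. norm x < \<epsilon>' \<Longrightarrow> \<bar>v x - c\<bar> < \<sigma>"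
    unfolding eventually_nhds_metric by (auto simp: dist_real_def c_def)
  obtain r0 where r0: "r0 > 0" "cball 0 r0 \<subseteq> \<Omega>" using \<Omega> open_contains_cball by blast
  define r where "r = min r0 (min \<epsilon> \<epsilon>') / 2"
  have r: "r > 0" "r < \<epsilon>" "r < \<epsilon>'" "r \<le> r0" using r0(1) \<epsilon>(1) \<epsilon>'(1) by (auto simp: r_def)
  have "cball 0 r \<subseteq> \<Omega>" using r0(2) subset_cball[OF r(4), of 0] by blast
  show False
  proof (rule distr_superharmonic_no_strict_affine_minorant[OF dim r(1) punctured(1,2) _ punctured(3) superharmonic _ low])
    show "cball 0 r - {0} \<subseteq> \<Omega> - {0}" using \<open>cball 0 r \<subseteq> \<Omega>\<close> by auto
    fix x :: "real^'n" assume x: "x \<noteq> 0" "norm x \<le> r"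
    hence "x \<in> \<Omega> - {0}" using \<open>cball 0 r \<subseteq> \<Omega>\<close> by auto
    hence "u x > v x" using u_gt_v[of x] \<Omega>_sub by auto
    moreover have "gradient v 0 \<bullet> x \<le> v x - c"
      using \<epsilon>(2)[of x] psi_le[OF \<epsilon>'(2)[of x]] x r by simp
    ultimately show "u x > v 0 + gradient v 0 \<bullet> x" unfolding c_def by linarith
  qed
qed
end

lemma liminf_zero_cases:
  fixes u v :: "real^'n \<Rightarrow> real"
  assumes \<Omega>: "open \<Omega>" "0 \<in> \<Omega>" and gt: "\<And>x. x \<in> \<Omega> - {0} \<Longrightarrow> u x > v x"
    and v: "isCont v 0"
    and np: "\<not> Liminf (at 0) (\<lambda>x. ereal (u x - v x)) > 0"
  shows "Liminf (at 0) (\<lambda>x. ereal (u x - v x)) = 0"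
    and "\<epsilon> > 0 \<Longrightarrow> d > 0 \<Longrightarrow> \<exists>x. x \<noteq> 0 \<and> norm x < d \<and> u x < v 0 + \<epsilon>"
proof -
  have "\<forall>\<^sub>F x in at 0. x \<in> \<Omega> - {0}"
    using eventually_nhds_in_open[OF \<Omega>] by (simp add: eventually_at_filter eventually_mono)
  hence "\<forall>\<^sub>F x in at 0. 0 \<le> ereal (u x - v x)"
    by eventually_elim (use gt in force)
  hence "0 \<le> Liminf (at 0) (\<lambda>x. ereal (u x - v x))" by (rule Liminf_bounded)
  thus "Liminf (at 0) (\<lambda>x. ereal (u x - v x)) = 0" using np by simp
  show "\<exists>x. x \<noteq> 0 \<and> norm x < d \<and> u x < v 0 + \<epsilon>" if \<epsilon>: "\<epsilon> > 0" and d: "d > 0"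
  proof (rule ccontr)
    assume no: "\<not> ?thesis"
    have "\<forall>\<^sub>F x in at 0. v x < v 0 + \<epsilon>/2"
      by (rule order_tendstoD(2)[of v "v 0"]) (use v \<epsilon> in \<open>auto simp: isCont_def\<close>)
    moreover have "\<forall>\<^sub>F x in at (0::real^'n). x \<noteq> 0 \<and> norm x < d"
      unfolding eventually_at using d by (intro exI[of _ d]) auto
    ultimately have "\<forall>\<^sub>F x in at 0. ereal (\<epsilon>/2) \<le> ereal (u x - v x)"
    proof eventually_elim
      case (elim x)
      thus ?case using no by (force simp: not_less)
    qed
    hence "ereal (\<epsilon>/2) \<le> Liminf (at 0) (\<lambda>x. ereal (u x - v x))" by (rule Liminf_bounded)
    moreover have "0 < ereal (\<epsilon>/2)" using \<epsilon> by simp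
    ultimately show False using np by (meson less_le_trans)
  qed
qed

theorem theorem1p9:
  fixes \<Omega> U W :: "(real^'n) set" and u v :: "real^'n \<Rightarrow> real"
    and \<phi> :: "real \<Rightarrow> real" and J :: "real set"
  assumes "CARD('n) \<ge> 2"
    and "open \<Omega>" and "bounded \<Omega>" and "0 \<in> \<Omega>"
    and "open J" and "1 \<in> J" and "\<phi> C1_differentiable_on J"
    and "\<phi> 1 = 1" and "deriv \<phi> 1 < 0"
    and "continuous_on (closure \<Omega> - {0}) u"
    and "open U" and "closure \<Omega> \<subseteq> U" and "continuous_on U v"
    and "open W" and "0 \<in> W" and "Ck_on 1 W v"
    and "\<And>x. x \<in> closure \<Omega> \<Longrightarrow> v x > 0"
    and "\<And>x. x \<in> closure \<Omega> - {0} \<Longrightarrow> u x > v x"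
    and "distr_laplacian_nonpos_on (\<Omega> - {0}) u"
    and "\<exists>\<epsilon>\<^sub>3>0. \<forall>x l. norm x < \<epsilon>\<^sub>3 \<longrightarrow> \<bar>l - 1\<bar> < \<epsilon>\<^sub>3 \<longrightarrow>
           (INF y\<in>\<Omega> - {0}. ereal (u y - v_phi \<phi> v x l y)) = 0 \<longrightarrow>
           Liminf (at 0) (\<lambda>y. ereal (u y - v_phi \<phi> v x l y)) = 0"
  shows "(deriv \<phi> 1 < -1 \<longrightarrow> Liminf (at 0) (\<lambda>x. ereal (u x - v x)) > 0) \<and>
    (-1 \<le> deriv \<phi> 1 \<and> deriv \<phi> 1 < 0 \<longrightarrow>
       Liminf (at 0) (\<lambda>x. ereal (u x - v x)) > 0 \<or>
       Liminf (at 0) (\<lambda>x. ereal (u x - v x)) = 0 \<and>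
         (\<exists>\<epsilon>>0. \<exists>V. \<forall>x. norm x < \<epsilon> \<longrightarrow> psi \<phi> (v 0) (v x) + V \<bullet> x = 0))"
proof (cases "Liminf (at 0) (\<lambda>x. ereal (u x - v x)) > 0")
  case True
  thus ?thesis by blast
next
  case False
  have sub: "\<Omega> \<subseteq> closure \<Omega>" by (rule closure_subset)
  have "isCont v 0"
    using assms(4,11,12,13) sub continuous_on_eq_continuous_at by blast
  moreover have "u x > v x" if "x \<in> \<Omega> - {0}" for x
    using that sub assms(18)[of x] by blast
  ultimately have lim0: "Liminf (at 0) (\<lambda>x. ereal (u x - v x)) = 0"
    and low: "\<And>\<epsilon> d. \<epsilon> > 0 \<Longrightarrow> d > 0 \<Longrightarrow> \<exists>x. x \<noteq> 0 \<and> norm x < d \<and> u x < v 0 + \<epsilon>"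
    using liminf_zero_cases[OF assms(2,4) _ _ False] by blast+
  obtain \<epsilon>3 where \<epsilon>3: "\<epsilon>3 > 0" "\<forall>x l. norm x < \<epsilon>3 \<longrightarrow> \<bar>l - 1\<bar> < \<epsilon>3 \<longrightarrow>
           (INF y\<in>\<Omega> - {0}. ereal (u y - v_phi \<phi> v x l y)) = 0 \<longrightarrow>
           Liminf (at 0) (\<lambda>y. ereal (u y - v_phi \<phi> v x l y)) = 0"
    using assms(20) by blast
  interpret dilation_family \<Omega> U W u v \<phi> J \<epsilon>3
    by unfold_locales (use assms(1-19) \<epsilon>3 low in blast)+
  obtain \<epsilon> where \<epsilon>: "\<epsilon> > 0" "\<And>x. norm x < \<epsilon> \<Longrightarrow> psi \<phi> (v 0) (v x) = gradient v 0 \<bullet> x"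
    using psi_eq_affine by blast
  hence "\<exists>\<epsilon>>0. \<exists>V. \<forall>x. norm x < \<epsilon> \<longrightarrow> psi \<phi> (v 0) (v x) + V \<bullet> x = 0"
    by (intro exI[of _ \<epsilon>] conjI exI[of _ "- gradient v 0"]) simp_all
  thus ?thesis using deriv_ge_minus_1 lim0 by auto
qed

end
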